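(* If $A$ is a flanked decomposition space, then $i^*A$ is a Segal space.
   Context: $\mathbf{Grpd}$ is the $\infty$-category of $\infty$-groupoids; pullbacks are homotopy pullbacks. $\Delta$ is the category of nonempty finite ordinals. A map in $\Delta$ is generic if it preserves both end-points, and free if $f(i+1)=f(i)+1$ for all $i$; generic and free maps admit pushouts along each other. A decomposition space is a functor $X:\Delta^{\mathrm{op}}\to\mathbf{Grpd}$ sending every pushout square in $\Delta$ of a generic map along a free map to a pullback. A Segal space is a simplicial $\infty$-groupoid whose Segal maps $X_r\to X_1\times_{X_0}\cdots\times_{X_0}X_1$ are equivalences. $\Xi$ is (a skeleton of) the category of finite strict intervals: finite linear orders with a bottom and a top element which are distinct, and maps preserving order, bottom and top. The object with $k+1$ elements besides bottom and top is denoted $[k]$, $k\ge-1$; $[-1]$ is initial. The functor $i:\Delta\to\Xi$, $i([k])=[k]$, freely adjoins new bottom and top elements, and is left adjoint to the forgetful functor $u:\Xi\to\Delta$, $u([k])=[k+2]$. Precomposition with $i$ gives $i^*:\mathrm{Fun}(\Xi^{\mathrm{op}},\mathbf{Grpd})\to\mathrm{Fun}(\Delta^{\mathrm{op}},\mathbf{Grpd})$ (underlying simplicial space). Compared with $\Delta$, $\Xi$ has an extra coface map $[-1]\to[0]$ and extra outer codegeneracy maps $[n]\to[n-1]$: one sends the smallest inner element to bottom, the other sends the largest inner element to top, and both are otherwise bijective. For $A:\Xi^{\mathrm{op}}\to\mathbf{Grpd}$ they induce $s_{\bot-1},s_{\top+1}:A_{n-1}\to A_n$. $A$ is flanked if for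 all $n\ge0$ the following commutative squares are pullbacks: the one with $d_\top:A_n\to A_{n-1}$, $d_\top:A_{n+1}\to A_n$ and $s_{\bot-1}:A_{n-1}\to A_n$, $s_{\bot-1}:A_n\to A_{n+1}$; and the one with $d_\bot:A_n\to A_{n-1}$, $d_\bot:A_{n+1}\to A_n$ and $s_{\top+1}:A_{n-1}\to A_n$, $s_{\top+1}:A_n\to A_{n+1}$ (where the face map $A_0\to A_{-1}$ counts both as $d_\top$ and as $d_\bot$). A flanked decomposition space is a flanked $A:\Xi^{\mathrm{op}}\to\mathbf{Grpd}$ such that $i^*A$ is a decomposition space. *)

theory Defs
  imports "HOL-Analysis.Analysis"
begin

section \<open>Spaces: CW complexes and homotopy equivalences\<close>

definition disk :: "nat \<Rightarrow> (nat \<Rightarrow> real) topology" where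
  "disk n = subtopology (Euclidean_space n) {x. (\<Sum>i<n. (x i)\<^sup>2) \<le> 1}"

definition open_disk :: "nat \<Rightarrow> (nat \<Rightarrow> real) set" where
  "open_disk n = {x \<in> topspace (disk n). (\<Sum>i<n. (x i)\<^sup>2) < 1}"

text \<open>A cell is a pair of a dimension and a characteristic map.\<close>

type_synonym 'a cell = "nat \<times> ((nat \<Rightarrow> real) \<Rightarrow> 'a)"

definition open_cell :: "'a cell \<Rightarrow> 'a set" where
  "open_cell c = snd c ` open_disk (fst c)"

definition CW_structure :: "'a topology \<Rightarrow> 'a cell set \<Rightarrow> bool" where
  "CW_structure X E \<longleftrightarrow>
     (\<forall>(n, \<Phi>) \<in> E. continuous_map (disk n) X \<Phi> \<and> inj_on \<Phi> (open_disk n)) \<and>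
     pairwise (\<lambda>c c'. open_cell c \<inter> open_cell c' = {}) E \<and>
     \<Union> (open_cell ` E) = topspace X \<and>
     (\<forall>(n, \<Phi>) \<in> E. \<exists>F \<subseteq> E. finite F \<and> (\<forall>c \<in> F. fst c < n) \<and>
        \<Phi> ` (topspace (disk n) - open_disk n) \<subseteq> \<Union> (open_cell ` F)) \<and>
     (\<forall>S \<subseteq> topspace X.
        (\<forall>(n, \<Phi>) \<in> E. closedin (disk n) {z \<in> topspace (disk n). \<Phi> z \<in> S}) \<longrightarrow> closedin X S)"

definition CW_complex :: "'a topology \<Rightarrow> bool" where
  "CW_complex X \<longleftrightarrow> Hausdorff_space X \<and> (\<exists>E. CW_structure X E)"

definition homotopy_equivalence :: "'a topology \<Rightarrow> 'b topology \<Rightarrow> ('a \<Rightarrow> 'b) \<Rightarrow> bool" where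
  "homotopy_equivalence X Y f \<longleftrightarrow>
     continuous_map X Y f \<and>
     (\<exists>g. continuous_map Y X g \<and>
          homotopic_with (\<lambda>_. True) X X (g \<circ> f) id \<and>
          homotopic_with (\<lambda>_. True) Y Y (f \<circ> g) id)"

text \<open>The space of paths in \<open>X\<close>, with the compact-open topology.\<close>

definition path_set :: "'a topology \<Rightarrow> (real \<Rightarrow> 'a) set" where
  "path_set X = {\<gamma> \<in> extensional {0..1}. pathin X \<gamma>}"

definition path_space :: "'a topology \<Rightarrow> (real \<Rightarrow> 'a) topology" where
  "path_space X = topology_generated_by
     {{\<gamma> \<in> path_set X. \<gamma> ` K \<subseteq> U} | K U. compact K \<and> K \<subseteq> {0..1} \<and> openin X U}"

text \<open>The homotopy pullback of \<open>f : X \<rightarrow> Z\<close> and \<open>g : Y \<rightarrow> Z\<close>.\<close>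

definition homotopy_pullback ::
  "'a topology \<Rightarrow> 'b topology \<Rightarrow> 'c topology \<Rightarrow> ('a \<Rightarrow> 'c) \<Rightarrow> ('b \<Rightarrow> 'c)
     \<Rightarrow> ('a \<times> (real \<Rightarrow> 'c) \<times> 'b) topology" where
  "homotopy_pullback X Y Z f g =
     subtopology (prod_topology X (prod_topology (path_space Z) Y))
       {(x, \<gamma>, y). \<gamma> 0 = f x \<and> \<gamma> 1 = g y}"

section \<open>Small categories\<close>

record ('o, 'm) category =
  Obj :: "'o set"
  Arr :: "'m set"
  Dom :: "'m \<Rightarrow> 'o"
  Cod :: "'m \<Rightarrow> 'o"
  Ident :: "'o \<Rightarrow> 'm"
  Cmp :: "'m \<Rightarrow> 'm \<Rightarrow> 'm"   \<comment> \<open>\<open>Cmp C g f\<close> is \<open>g \<circ> f\<close>\<close>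

definition comm_square :: "('o, 'm) category \<Rightarrow> 'm \<Rightarrow> 'm \<Rightarrow> 'm \<Rightarrow> 'm \<Rightarrow> bool" where
  "comm_square C f h g k \<longleftrightarrow>
     {f, h, g, k} \<subseteq> Arr C \<and> Dom C f = Dom C g \<and>
     Cod C f = Dom C h \<and> Cod C g = Dom C k \<and> Cod C h = Cod C k \<and>
     Cmp C h f = Cmp C k g"

definition pushout_square :: "('o, 'm) category \<Rightarrow> 'm \<Rightarrow> 'm \<Rightarrow> 'm \<Rightarrow> 'm \<Rightarrow> bool" where
  "pushout_square C f h g k \<longleftrightarrow>
     comm_square C f h g k \<and>
     (\<forall>u v. comm_square C f u g v \<longrightarrow>
        (\<exists>!w. w \<in> Arr C \<and> Dom C w = Cod C h \<and> Cod C w = Cod C u \<and>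
              Cmp C w h = u \<and> Cmp C w k = v))"

section \<open>Infinity-functors from the opposite of a category to infinity-groupoids\<close>

text \<open>
  The infinity-category of infinity-groupoids is taken to be the homotopy coherent nerve of the
  category of CW complexes, enriched in simplicial sets by the singular complexes of mapping
  spaces.  Maps of simplicial sets from the nerve of the opposite of \<open>C\<close> into it are Vogt's
  homotopy coherent diagrams: to every object \<open>x\<close> a CW complex \<open>space_at A x\<close>, and to every
  chain \<open>x\<^sub>0 \<rightarrow> x\<^sub>1 \<rightarrow> \<dots> \<rightarrow> x\<^sub>n\<close> with arrows \<open>fs = [f\<^sub>1, \<dots>, f\<^sub>n]\<close> (in this order, so
  \<open>Cod f\<^sub>i = Dom f\<^sub>i\<^sub>+\<^sub>1\<close>), \<open>n \<ge> 1\<close>, a cube of maps from the space at \<open>x\<^sub>n\<close> to the space at \<open>x\<^sub>0\<close>,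
  written \<open>act A fs [t\<^sub>1, \<dots>, t\<^sub>n\<^sub>-\<^sub>1]\<close>.

  The cube is the mapping object from \<open>0\<close> to \<open>n\<close> in the simplicial category freely generated by
  the \<open>n\<close>-simplex, i.e. the nerve of the poset of subsets of \<open>{0, \<dots>, n}\<close> containing \<open>0\<close> and \<open>n\<close>;
  the coordinate \<open>t\<^sub>j\<close> is the membership of \<open>j\<close>.  So \<open>t\<^sub>j = 1\<close> is composition at \<open>x\<^sub>j\<close>, \<open>t\<^sub>j = 0\<close> is
  the inner face omitting \<open>x\<^sub>j\<close>, and a degeneracy, which merges two neighbouring vertices, takes
  the maximum of their coordinates (being \<open>1\<close> at the end vertices).  In particular
  \<open>act A [f, g] [t]\<close> is a homotopy from \<open>act A [g \<circ> f] []\<close> at \<open>t = 0\<close> to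
  \<open>act A [f] [] \<circ> act A [g] []\<close> at \<open>t = 1\<close>.
\<close>

record ('o, 'm, 'a) presheaf =
  space_at :: "'o \<Rightarrow> 'a topology"
  act :: "'m list \<Rightarrow> real list \<Rightarrow> 'a \<Rightarrow> 'a"

definition chain :: "('o, 'm) category \<Rightarrow> 'm list \<Rightarrow> bool" where
  "chain C fs \<longleftrightarrow>
     fs \<noteq> [] \<and> set fs \<subseteq> Arr C \<and> successively (\<lambda>f g. Cod C f = Dom C g) fs"

definition cube_point :: "'m list \<Rightarrow> real list \<Rightarrow> bool" where
  "cube_point fs ts \<longleftrightarrow> length ts + 1 = length fs \<and> set ts \<subseteq> {0..1}"

definition cube :: "nat \<Rightarrow> (nat \<Rightarrow> real) topology" where
  "cube n = product_topology (\<lambda>_. top_of_set {0..1}) {..<n}"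

definition inf_presheaf :: "('o, 'm) category \<Rightarrow> ('o, 'm, 'a) presheaf \<Rightarrow> bool" where
  "inf_presheaf C A \<longleftrightarrow>
     (\<forall>x \<in> Obj C. CW_complex (space_at A x)) \<and>
     \<comment> \<open>continuity\<close>
     (\<forall>fs. chain C fs \<longrightarrow>
        continuous_map
          (prod_topology (cube (length fs - 1)) (space_at A (Cod C (last fs))))
          (space_at A (Dom C (hd fs)))
          (\<lambda>(t, a). act A fs (map t [0..<length fs - 1]) a)) \<and>
     \<comment> \<open>composition\<close>
     (\<forall>us vs ps qs a.
        us \<noteq> [] \<longrightarrow> vs \<noteq> [] \<longrightarrow> chain C (us @ vs) \<longrightarrow>
        cube_point us ps \<longrightarrow> cube_point vs qs \<longrightarrow>
        a \<in> topspace (space_at A (Cod C (last vs))) \<longrightarrow>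
        act A (us @ vs) (ps @ 1 # qs) a = act A us ps (act A vs qs a)) \<and>
     \<comment> \<open>inner faces\<close>
     (\<forall>us f g vs ps qs a.
        chain C (us @ f # g # vs) \<longrightarrow> cube_point (us @ f # g # vs) (ps @ 0 # qs) \<longrightarrow>
        length ps = length us \<longrightarrow>
        a \<in> topspace (space_at A (Cod C (last (g # vs)))) \<longrightarrow>
        act A (us @ f # g # vs) (ps @ 0 # qs) a = act A (us @ Cmp C g f # vs) (ps @ qs) a) \<and>
     \<comment> \<open>degeneracies: a single identity, and an identity at the start, at the end or in the
         middle of a chain\<close>
     (\<forall>x \<in> Obj C. \<forall>a \<in> topspace (space_at A x). act A [Ident C x] [] a = a) \<and>
     (\<forall>x \<in> Obj C. \<forall>vs t qs a.
        chain C (Ident C x # vs) \<longrightarrow> cube_point (Ident C x # vs) (t # qs) \<longrightarrow>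
        a \<in> topspace (space_at A (Cod C (last vs))) \<longrightarrow>
        act A (Ident C x # vs) (t # qs) a = act A vs qs a) \<and>
     (\<forall>x \<in> Obj C. \<forall>us ps t a.
        chain C (us @ [Ident C x]) \<longrightarrow> cube_point (us @ [Ident C x]) (ps @ [t]) \<longrightarrow>
        a \<in> topspace (space_at A x) \<longrightarrow>
        act A (us @ [Ident C x]) (ps @ [t]) a = act A us ps a) \<and>
     (\<forall>x \<in> Obj C. \<forall>us vs ps s t qs a.
        us \<noteq> [] \<longrightarrow> vs \<noteq> [] \<longrightarrow> chain C (us @ Ident C x # vs) \<longrightarrow>
        cube_point (us @ Ident C x # vs) (ps @ s # t # qs) \<longrightarrow>
        length ps + 1 = length us \<longrightarrow>
        a \<in> topspace (space_at A (Cod C (last vs))) \<longrightarrow>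
        act A (us @ Ident C x # vs) (ps @ s # t # qs) a = act A (us @ vs) (ps @ max s t # qs) a)"

text \<open>
  A commutative square \<open>h \<circ> f = k \<circ> g\<close> in \<open>C\<close> gives, for every point \<open>a\<close> of the space at
  the codomain of \<open>h\<close>, a path from \<open>act A [f] [] (act A [h] [] a)\<close> through \<open>act A [h \<circ> f] [] a\<close>
  to \<open>act A [g] [] (act A [k] [] a)\<close>.
\<close>

definition square_path ::
  "('o, 'm, 'a) presheaf \<Rightarrow> 'm \<Rightarrow> 'm \<Rightarrow> 'm \<Rightarrow> 'm \<Rightarrow> 'a \<Rightarrow> real \<Rightarrow> 'a" where
  "square_path A f h g k a =
     (\<lambda>t\<in>{0..1}. if t \<le> 1/2 then act A [f, h] [1 - 2 * t] a else act A [g, k] [2 * t - 1] a)"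

definition sends_to_pullback ::
  "('o, 'm) category \<Rightarrow> ('o, 'm, 'a) presheaf \<Rightarrow> 'm \<Rightarrow> 'm \<Rightarrow> 'm \<Rightarrow> 'm \<Rightarrow> bool" where
  "sends_to_pullback C A f h g k \<longleftrightarrow>
     homotopy_equivalence
       (space_at A (Cod C h))
       (homotopy_pullback (space_at A (Cod C f)) (space_at A (Cod C g)) (space_at A (Dom C f))
          (act A [f] []) (act A [g] []))
       (\<lambda>a. (act A [h] [] a, square_path A f h g k a, act A [k] [] a))"

section \<open>The categories \<open>\<Delta>\<close> and \<open>\<Xi>\<close>\<close>

text \<open>
  Objects are integers.  In \<open>\<Delta>\<close> the object \<open>[n]\<close> is \<open>{0..n}\<close>; in \<open>\<Xi>\<close> it is the interval
  \<open>{-1..n + 1}\<close> with bottom \<open>-1\<close> and top \<open>n + 1\<close>, so that its inner elements form the \<open>[n]\<close>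
  of \<open>\<Delta>\<close>.  An arrow \<open>(m, n, f)\<close> goes from \<open>[m]\<close> to \<open>[n]\<close>.
\<close>

type_synonym order_map = "int \<times> int \<times> (int \<Rightarrow> int)"

definition Delta :: "(int, order_map) category" where
  "Delta = \<lparr>
     Obj = {0..},
     Arr = {(m, n, f). 0 \<le> m \<and> 0 \<le> n \<and> f \<in> {0..m} \<rightarrow>\<^sub>E {0..n} \<and> mono_on {0..m} f},
     Dom = (\<lambda>(m, n, f). m),
     Cod = (\<lambda>(m, n, f). n),
     Ident = (\<lambda>n. (n, n, \<lambda>i\<in>{0..n}. i)),
     Cmp = (\<lambda>(_, n, g) (m, _, f). (m, n, compose {0..m} g f)) \<rparr>"

definition Xi :: "(int, order_map) category" where
  "Xi = \<lparr>
     Obj = {-1..},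
     Arr = {(m, n, f). -1 \<le> m \<and> -1 \<le> n \<and> f \<in> {-1..m + 1} \<rightarrow>\<^sub>E {-1..n + 1} \<and>
                       mono_on {-1..m + 1} f \<and> f (-1) = -1 \<and> f (m + 1) = n + 1},
     Dom = (\<lambda>(m, n, f). m),
     Cod = (\<lambda>(m, n, f). n),
     Ident = (\<lambda>n. (n, n, \<lambda>i\<in>{-1..n + 1}. i)),
     Cmp = (\<lambda>(_, n, g) (m, _, f). (m, n, compose {-1..m + 1} g f)) \<rparr>"

text \<open>The functor \<open>i : \<Delta> \<rightarrow> \<Xi>\<close> is the identity on objects; this is its action on arrows.\<close>

definition adjoin_ends :: "order_map \<Rightarrow> order_map" where
  "adjoin_ends = (\<lambda>(m, n, f).
     (m, n, \<lambda>i\<in>{-1..m + 1}. if i = -1 then -1 else if i = m + 1 then n + 1 else f i))"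

definition underlying :: "(int, order_map, 'a) presheaf \<Rightarrow> (int, order_map, 'a) presheaf" where
  "underlying A = \<lparr> space_at = space_at A, act = (\<lambda>fs. act A (map adjoin_ends fs)) \<rparr>"

section \<open>Decomposition spaces and Segal spaces\<close>

definition generic_map :: "order_map \<Rightarrow> bool" where
  "generic_map = (\<lambda>(m, n, f). f 0 = 0 \<and> f m = n)"

definition free_map :: "order_map \<Rightarrow> bool" where
  "free_map = (\<lambda>(m, n, f). \<forall>i\<in>{0..<m}. f (i + 1) = f i + 1)"

definition decomposition_space :: "(int, order_map, 'a) presheaf \<Rightarrow> bool" where
  "decomposition_space X \<longleftrightarrow>
     inf_presheaf Delta X \<and>
     (\<forall>f h g k. pushout_square Delta f h g k \<longrightarrow> generic_map f \<longrightarrow> free_map g \<longrightarrow>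
        sends_to_pullback Delta X f h g k)"

definition source_vertex :: order_map where
  "source_vertex = (0, 1, \<lambda>i\<in>{0..0}. 0)"

definition target_vertex :: order_map where
  "target_vertex = (0, 1, \<lambda>i\<in>{0..0}. 1)"

definition spine_edge :: "nat \<Rightarrow> nat \<Rightarrow> order_map" where
  "spine_edge r j = (1, int r, \<lambda>i\<in>{0..1}. int j + i)"

text \<open>
  The homotopy limit \<open>X\<^sub>1 \<times>\<^bsub>X\<^sub>0\<^esub> \<cdots> \<times>\<^bsub>X\<^sub>0\<^esub> X\<^sub>1\<close> with \<open>r \<ge> 1\<close> factors: \<open>r\<close> points of \<open>X\<^sub>1\<close>
  and paths in \<open>X\<^sub>0\<close> from the target of each of them to the source of the next one.
\<close>

definition segal_limit ::
  "(int, order_map, 'a) presheaf \<Rightarrow> nat \<Rightarrow> ((nat \<Rightarrow> 'a) \<times> (nat \<Rightarrow> real \<Rightarrow> 'a)) topology" where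
  "segal_limit X r =
     subtopology
       (prod_topology (product_topology (\<lambda>_. space_at X 1) {..<r})
                      (product_topology (\<lambda>_. path_space (space_at X 0)) {..<r - 1}))
       {(x, \<gamma>). \<forall>j<r - 1. \<gamma> j 0 = act X [target_vertex] [] (x j) \<and>
                           \<gamma> j 1 = act X [source_vertex] [] (x (Suc j))}"

definition segal_map ::
  "(int, order_map, 'a) presheaf \<Rightarrow> nat \<Rightarrow> 'a \<Rightarrow> (nat \<Rightarrow> 'a) \<times> (nat \<Rightarrow> real \<Rightarrow> 'a)" where
  "segal_map X r a =
     (\<lambda>j\<in>{..<r}. act X [spine_edge r j] [] a,
      \<lambda>j\<in>{..<r - 1}.
        square_path X target_vertex (spine_edge r j) source_vertex (spine_edge r (Suc j)) a)"

text \<open>For \<open>r = 0\<close> the Segal map is the identity of \<open>X\<^sub>0\<close>.\<close>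

definition segal_space :: "(int, order_map, 'a) presheaf \<Rightarrow> bool" where
  "segal_space X \<longleftrightarrow>
     inf_presheaf Delta X \<and>
     (\<forall>r\<ge>1. homotopy_equivalence (space_at X (int r)) (segal_limit X r) (segal_map X r))"

section \<open>Flanked decomposition spaces\<close>

text \<open>
  The cofaces \<open>[n - 1] \<rightarrow> [n]\<close> and the extra codegeneracies \<open>[n] \<rightarrow> [n - 1]\<close> in \<open>\<Xi>\<close>, for
  \<open>n \<ge> 0\<close>.  For \<open>n = 0\<close> the two cofaces are both the map \<open>[-1] \<rightarrow> [0]\<close>.
\<close>

definition coface_bot :: "int \<Rightarrow> order_map" where
  "coface_bot n = (n - 1, n, \<lambda>i\<in>{-1..n}. if i = -1 then -1 else i + 1)"

definition coface_top :: "int \<Rightarrow> order_map" where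
  "coface_top n = (n - 1, n, \<lambda>i\<in>{-1..n}. if i = n then n + 1 else i)"

definition extra_codeg_bot :: "int \<Rightarrow> order_map" where
  "extra_codeg_bot n = (n, n - 1, \<lambda>i\<in>{-1..n + 1}. if i = -1 then -1 else i - 1)"

definition extra_codeg_top :: "int \<Rightarrow> order_map" where
  "extra_codeg_top n = (n, n - 1, \<lambda>i\<in>{-1..n + 1}. if i = n + 1 then n else i)"

definition flanked :: "(int, order_map, 'a) presheaf \<Rightarrow> bool" where
  "flanked A \<longleftrightarrow>
     (\<forall>n\<ge>0.
        sends_to_pullback Xi A
          (extra_codeg_bot n) (coface_top n) (coface_top (n + 1)) (extra_codeg_bot (n + 1)) \<and>
        sends_to_pullback Xi A
          (extra_codeg_top n) (coface_bot n) (coface_bot (n + 1)) (extra_codeg_top (n + 1)))"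

definition flanked_decomposition_space :: "(int, order_map, 'a) presheaf \<Rightarrow> bool" where
  "flanked_decomposition_space A \<longleftrightarrow>
     inf_presheaf Xi A \<and> flanked A \<and> decomposition_space (underlying A)"

end

theory Submission
  imports Defs
begin

text \<open>
  Homotopy pullbacks paste: if the right one of two adjacent squares is a homotopy pullback, then the
  left one is if and only if the outer rectangle is.  In \<open>\<Xi>\<close> the composite
  \<open>[n - 1] \<rightarrow> [n] \<rightarrow> [n - 1]\<close> of the inner coface skipping \<open>1\<close> and the extra bottom codegeneracy
  equals the composite \<open>[n - 1] \<rightarrow> [n - 2] \<rightarrow> [n - 1]\<close> of the extra bottom codegeneracy and the bottom
  coface.  For \<open>n \<ge> 2\<close> the first factorisation exhibits the rectangle over \<open>d\<^sub>\<top>\<close> as a pasting of a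
  flanking square and a generic-free pushout square, so the rectangle is a pullback; in the second
  one the right square is the flanking square for \<open>n - 1\<close>, so its left square, which compares \<open>d\<^sub>\<bottom>\<close>
  with \<open>d\<^sub>\<top>\<close>, is a pullback too.  Pasting these squares gives
  \<open>X\<^sub>r \<simeq> X\<^sub>r\<^sub>-\<^sub>1 \<times> X\<^sub>1\<close> over \<open>X\<^sub>0\<close>, and the Segal condition follows by induction on \<open>r\<close>.
\<close>

section \<open>Homotopies and homotopy equivalences\<close>

text \<open>Flanking enters because a Segal square relates two outer cofaces. Neither of them is
  generic, so the decomposition axiom says nothing about such a square directly; the identity in
  \<open>Xi\<close> trades an outer coface for an inner one, which is generic. Most of the work is
  caused by homotopy coherence. Squares commute only up to the paths \<open>square_path\<close>, and
  being sent to a pullback refers to exactly these paths. Pasting homotopy pullbacks of spaces is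
  therefore only half of the pasting lemma: the path of the outer rectangle must also be deformed
  into the concatenated paths of the two squares. The two-dimensional cubes
  \<open>act A [f, g, h] [s, t]\<close> provide the deformation. They are needed once more for the
  Segal maps, because restricting to an edge of \<open>[r + 1]\<close> agrees only up to homotopy
  with restricting to \<open>[r]\<close> first and then to the edge.\<close>

abbreviation unit_interval :: "real topology" where
  "unit_interval \<equiv> top_of_set {0..1}"

abbreviation homotopic :: "'a topology \<Rightarrow> 'b topology \<Rightarrow> ('a \<Rightarrow> 'b) \<Rightarrow> ('a \<Rightarrow> 'b) \<Rightarrow> bool" where
  "homotopic \<equiv> homotopic_with (\<lambda>_. True)"

lemma homotopicI:
  assumes "continuous_map (prod_topology unit_interval X) Y (\<lambda>p. h (fst p) (snd p))"
    and "\<And>x. x \<in> topspace X \<Longrightarrow> h 0 x = f x" "\<And>x. x \<in> topspace X \<Longrightarrow> h 1 x = g x"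
  shows "homotopic X Y f g"
  using assms by (subst homotopic_with) (auto intro!: exI[where x = "\<lambda>p. h (fst p) (snd p)"])

lemma homotopicE:
  assumes "homotopic X Y f g"
  obtains h where "continuous_map (prod_topology unit_interval X) Y (\<lambda>p. h (fst p) (snd p))"
    "\<And>x. h 0 x = f x" "\<And>x. h 1 x = g x"
proof -
  obtain k where "continuous_map (prod_topology unit_interval X) Y k"
    "\<And>x. k (0, x) = f x" "\<And>x. k (1, x) = g x"
    using assms unfolding homotopic_with_def by auto
  then show thesis
    using that[of "\<lambda>t x. k (t, x)"] by simp
qed

lemma homotopic_trans [trans]:
  "homotopic X Y f g \<Longrightarrow> homotopic X Y g h \<Longrightarrow> homotopic X Y f h"
  by (rule homotopic_with_trans)

lemma homotopic_sym: "homotopic X Y f g \<Longrightarrow> homotopic X Y g f"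
  by (rule homotopic_with_symD)

lemma homotopic_comp_left:
  "homotopic X Y f g \<Longrightarrow> continuous_map Y Z h \<Longrightarrow> homotopic X Z (h \<circ> f) (h \<circ> g)"
  by (erule homotopic_with_compose_continuous_map_left) auto

lemma homotopic_comp_right:
  "homotopic Y Z f g \<Longrightarrow> continuous_map X Y h \<Longrightarrow> homotopic X Z (f \<circ> h) (g \<circ> h)"
  by (erule homotopic_with_compose_continuous_map_right) auto

lemma homotopic_equal:
  "continuous_map X Y f \<Longrightarrow> (\<And>x. x \<in> topspace X \<Longrightarrow> f x = g x) \<Longrightarrow> homotopic X Y f g"
  by (rule homotopic_with_equal) auto

text \<open>Up to homotopy a left and a right inverse agree, since \<open>l\<close> is homotopic to
  \<open>l \<circ> f \<circ> r\<close> and this to \<open>r\<close>.\<close>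

lemma homotopy_equivalenceI2:
  assumes f: "continuous_map X Y f" and l: "continuous_map Y X l" and r: "continuous_map Y X r"
    and lf: "homotopic X X (l \<circ> f) id" and fr: "homotopic Y Y (f \<circ> r) id"
  shows "homotopy_equivalence X Y f"
proof -
  have "homotopic Y X l (l \<circ> f \<circ> r)"
    using homotopic_comp_left[OF homotopic_sym[OF fr] l] by (simp add: o_assoc)
  also have "homotopic Y X (l \<circ> f \<circ> r) r"
    using homotopic_comp_right[OF lf r] by simp
  finally have "homotopic Y Y (f \<circ> l) (f \<circ> r)"
    by (rule homotopic_comp_left[OF _ f])
  also note fr
  finally show ?thesis
    unfolding homotopy_equivalence_def using f l lf by blast
qed

lemma homotopy_equivalence_homotopic:
  assumes "homotopy_equivalence X Y f" "homotopic X Y f f'"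
  shows "homotopy_equivalence X Y f'"
proof -
  obtain g where f: "continuous_map X Y f" and g: "continuous_map Y X g"
    and gf: "homotopic X X (g \<circ> f) id" and fg: "homotopic Y Y (f \<circ> g) id"
    using assms(1) unfolding homotopy_equivalence_def by auto
  show ?thesis
  proof (rule homotopy_equivalenceI2)
    show "continuous_map X Y f'"
      using assms(2) homotopic_with_imp_continuous_maps by blast
    show "homotopic X X (g \<circ> f') id"
      using homotopic_trans[OF homotopic_comp_left[OF homotopic_sym[OF assms(2)] g] gf] .
    show "homotopic Y Y (f' \<circ> g) id"
      using homotopic_trans[OF homotopic_comp_right[OF homotopic_sym[OF assms(2)] g] fg] .
  qed (rule g)+
qed

lemma homotopy_equivalence_cong:
  assumes "homotopy_equivalence X Y f" "\<And>x. x \<in> topspace X \<Longrightarrow> f x = f' x"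
  shows "homotopy_equivalence X Y f'"
  using assms(1)
  by (rule homotopy_equivalence_homotopic)
    (use assms in \<open>auto simp: homotopy_equivalence_def intro: homotopic_equal\<close>)

lemma homotopy_equivalence_compose:
  assumes "homotopy_equivalence X Y f" "homotopy_equivalence Y Z g"
  shows "homotopy_equivalence X Z (g \<circ> f)"
proof -
  obtain f' where f: "continuous_map X Y f" and f': "continuous_map Y X f'"
    and f'f: "homotopic X X (f' \<circ> f) id" and ff': "homotopic Y Y (f \<circ> f') id"
    using assms(1) unfolding homotopy_equivalence_def by auto
  obtain g' where g: "continuous_map Y Z g" and g': "continuous_map Z Y g'"
    and g'g: "homotopic Y Y (g' \<circ> g) id" and gg': "homotopic Z Z (g \<circ> g') id"
    using assms(2) unfolding homotopy_equivalence_def by auto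
  have "homotopic X X (f' \<circ> g' \<circ> (g \<circ> f)) (f' \<circ> f)"
    using homotopic_comp_right[OF homotopic_comp_left[OF g'g f'] f] by (simp add: o_assoc)
  also note f'f
  finally have 1: "homotopic X X (f' \<circ> g' \<circ> (g \<circ> f)) id" .
  have "homotopic Z Z (g \<circ> f \<circ> (f' \<circ> g')) (g \<circ> g')"
    using homotopic_comp_right[OF homotopic_comp_left[OF ff' g] g'] by (simp add: o_assoc)
  also note gg'
  finally have 2: "homotopic Z Z (g \<circ> f \<circ> (f' \<circ> g')) id" .
  show ?thesis
    using homotopy_equivalenceI2[OF continuous_map_compose[OF f g]] 1 2
      continuous_map_compose[OF g' f'] by blast
qed

text \<open>For situations where \<open>g \<circ> f\<close> and \<open>f \<circ> g\<close> are known
  to be invertible but not to be homotopic to the identity. Inverses of these composites, combined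
  with \<open>g\<close>, give a left and a right inverse of \<open>f\<close>.\<close>

lemma homotopy_equivalence_if_compositions:
  assumes f: "continuous_map X Y f" and g: "continuous_map Y X g"
    and gf: "homotopy_equivalence X X (g \<circ> f)" and fg: "homotopy_equivalence Y Y (f \<circ> g)"
  shows "homotopy_equivalence X Y f"
proof -
  obtain u where u: "continuous_map X X u" and ugf: "homotopic X X (u \<circ> (g \<circ> f)) id"
    using gf unfolding homotopy_equivalence_def by auto
  obtain v where v: "continuous_map Y Y v" and fgv: "homotopic Y Y (f \<circ> g \<circ> v) id"
    using fg unfolding homotopy_equivalence_def by auto
  show ?thesis
  proof (rule homotopy_equivalenceI2[OF f])
    show "continuous_map Y X (u \<circ> g)" "continuous_map Y X (g \<circ> v)"
      using u g v by (auto intro: continuous_map_compose)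
    show "homotopic X X (u \<circ> g \<circ> f) id" "homotopic Y Y (f \<circ> (g \<circ> v)) id"
      using ugf fgv by (simp_all add: o_assoc)
  qed
qed

lemma homotopy_equivalence_cancel_left:
  assumes g: "homotopy_equivalence Y Z g" and gf: "homotopy_equivalence X Z (g \<circ> f)"
    and f: "continuous_map X Y f"
  shows "homotopy_equivalence X Y f"
proof -
  obtain g' where g': "continuous_map Z Y g'" "homotopic Y Y (g' \<circ> g) id"
    "homotopic Z Z (g \<circ> g') id" and g: "continuous_map Y Z g"
    using g unfolding homotopy_equivalence_def by auto
  then have "homotopy_equivalence Z Y g'"
    unfolding homotopy_equivalence_def by auto
  then have "homotopy_equivalence X Y (g' \<circ> (g \<circ> f))"
    using gf by (rule homotopy_equivalence_compose[rotated])
  moreover have "homotopic X Y (g' \<circ> (g \<circ> f)) f"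
    using homotopic_comp_right[OF g'(2) f] by (simp add: o_assoc)
  ultimately show ?thesis
    by (rule homotopy_equivalence_homotopic)
qed

lemma homotopy_equivalence_inverse:
  assumes "continuous_map X Y f" "continuous_map Y X g"
    "\<And>x. x \<in> topspace X \<Longrightarrow> g (f x) = x" "\<And>y. y \<in> topspace Y \<Longrightarrow> f (g y) = y"
  shows "homotopy_equivalence X Y f"
  unfolding homotopy_equivalence_def using assms
  by (intro conjI exI[where x = g]) (auto intro: homotopic_with_id2)

section \<open>Path spaces\<close>

lemma continuous_map_unit_interval:
  assumes "continuous_map X euclideanreal r" "\<And>x. x \<in> topspace X \<Longrightarrow> 0 \<le> r x \<and> r x \<le> 1"
  shows "continuous_map X unit_interval r"
  using assms by (auto intro: continuous_map_into_subtopology)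

lemma unit_interval_real:
  "continuous_map X unit_interval r \<Longrightarrow> continuous_map X euclideanreal r"
  by (rule continuous_map_into_fulltopology)

lemma unit_interval_range:
  "continuous_map X unit_interval r \<Longrightarrow> x \<in> topspace X \<Longrightarrow> 0 \<le> r x \<and> r x \<le> 1"
  by (auto simp: continuous_map_in_subtopology Pi_iff)

lemma convex_unit:
  fixes s :: real
  assumes "0 \<le> s" "s \<le> 1" "0 \<le> a" "a \<le> 1" "0 \<le> b" "b \<le> 1"
  shows "0 \<le> (1 - s) * a + s * b \<and> (1 - s) * a + s * b \<le> 1"
  using assms convex_bound_le[of a 1 b "1 - s" s] by auto

lemma continuous_map_unit_convex:
  assumes "continuous_map X unit_interval s" "continuous_map X unit_interval a"
    "continuous_map X unit_interval b"
  shows "continuous_map X unit_interval (\<lambda>x. (1 - s x) * a x + s x * b x)"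
proof (rule continuous_map_unit_interval)
  show "continuous_map X euclideanreal (\<lambda>x. (1 - s x) * a x + s x * b x)"
    using assms[THEN unit_interval_real] by (intro continuous_intros) auto
  show "0 \<le> (1 - s x) * a x + s x * b x \<and> (1 - s x) * a x + s x * b x \<le> 1"
    if "x \<in> topspace X" for x
    using assms[THEN unit_interval_range[OF _ that]] by (intro convex_unit) auto
qed

lemma continuous_map_unit_const: "0 \<le> c \<Longrightarrow> c \<le> 1 \<Longrightarrow> continuous_map X unit_interval (\<lambda>x. c)"
  by simp

lemma continuous_map_unit_compl:
  "continuous_map X unit_interval r \<Longrightarrow> continuous_map X unit_interval (\<lambda>x. 1 - r x)"
  using unit_interval_range[of X r] unit_interval_real[of X r]
  by (auto intro!: continuous_map_unit_interval continuous_map_diff)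

lemma topspace_path_space [simp]: "topspace (path_space Z) = path_set Z"
proof -
  \<comment> \<open>The empty compact set \<open>K\<close> imposes no condition, so
    \<open>path_set Z\<close> is itself one of the generating sets.\<close>
  have "path_set Z \<in> {{\<gamma> \<in> path_set Z. \<gamma> ` K \<subseteq> U} |K U. compact K \<and> K \<subseteq> {0..1} \<and> openin Z U}"
    by (auto intro!: exI[where x = "{}"])
  then show ?thesis
    unfolding path_space_def by fastforce
qed

lemma path_set_iff:
  "\<gamma> \<in> path_set Z \<longleftrightarrow> \<gamma> \<in> extensional {0..1} \<and> continuous_map unit_interval Z \<gamma>"
  by (simp add: path_set_def pathin_def)

text \<open>One half of the exponential law for the interval. A subbasic set is given by a compact
  \<open>K\<close>, so the tube lemma applies to \<open>{x} \<times> K\<close>. The restriction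
  makes \<open>c x\<close> extensional, as points of \<open>path_set\<close> have to be.\<close>

lemma continuous_map_curry:
  assumes c: "continuous_map (prod_topology X unit_interval) Z (\<lambda>p. c (fst p) (snd p))"
  shows "continuous_map X (path_space Z) (\<lambda>x. restrict (c x) {0..1})"
  unfolding path_space_def
proof (rule continuous_on_generated_topo)
  have path: "restrict (c x) {0..1} \<in> path_set Z" if "x \<in> topspace X" for x
  proof -
    have "continuous_map unit_interval Z ((\<lambda>p. c (fst p) (snd p)) \<circ> Pair x)"
      by (rule continuous_map_o_Pair[OF c that])
    then show ?thesis
      by (simp add: path_set_iff o_def)
  qed
  then show "(\<lambda>x. restrict (c x) {0..1}) ` topspace X \<subseteq>
      \<Union> {{\<gamma> \<in> path_set Z. \<gamma> ` K \<subseteq> U} |K U. compact K \<and> K \<subseteq> {0..1} \<and> openin Z U}"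
    using topspace_path_space[of Z] unfolding path_space_def by auto
  fix V assume "V \<in> {{\<gamma> \<in> path_set Z. \<gamma> ` K \<subseteq> U} |K U. compact K \<and> K \<subseteq> {0..1} \<and> openin Z U}"
  then obtain K U where V: "V = {\<gamma> \<in> path_set Z. \<gamma> ` K \<subseteq> U}"
    and K: "compact K" "K \<subseteq> {0..1}" and U: "openin Z U"
    by auto
  let ?W = "{p \<in> topspace (prod_topology X unit_interval). c (fst p) (snd p) \<in> U}"
  have W: "openin (prod_topology X unit_interval) ?W"
    using c U by (rule openin_continuous_map_preimage)
  show "openin X ((\<lambda>x. restrict (c x) {0..1}) -` V \<inter> topspace X)"
  proof (subst openin_subopen, safe)
    fix x assume x: "x \<in> topspace X" and "restrict (c x) {0..1} \<in> V"
    then have sub: "{x} \<times> K \<subseteq> ?W"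
      using K V by force
    have "compactin unit_interval K"
      using K by (simp add: compactin_subtopology)
    from tube_lemma_right[OF W this x sub]
    obtain A B where AB: "openin X A" "x \<in> A" "K \<subseteq> B" "A \<times> B \<subseteq> ?W"
      by (elim exE conjE) (rule that)
    have "A \<subseteq> (\<lambda>x. restrict (c x) {0..1}) -` V \<inter> topspace X"
    proof
      fix x' assume x': "x' \<in> A"
      then have "x' \<in> topspace X"
        using openin_subset[OF AB(1)] by auto
      moreover have "restrict (c x') {0..1} t \<in> U" if "t \<in> K" for t
        using subsetD[OF AB(4), of "(x', t)"] x' that AB(3) K by auto
      ultimately show "x' \<in> (\<lambda>x. restrict (c x) {0..1}) -` V \<inter> topspace X"
        using path[of x'] unfolding V by (auto simp del: restrict_apply)
    qed
    then show "\<exists>T. openin X T \<and> x \<in> T \<and> T \<subseteq> (\<lambda>x. restrict (c x) {0..1}) -` V \<inter> topspace X"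
      using AB by blast
  qed
qed

text \<open>The other half of the exponential law, by local compactness of the interval: a small
  closed ball around \<open>t\<close> is a compact set that \<open>\<gamma>\<close> maps into
  \<open>U\<close>, and so it defines a subbasic neighbourhood of \<open>\<gamma>\<close>.\<close>

lemma continuous_map_path_eval:
  "continuous_map (prod_topology (path_space Z) unit_interval) Z (\<lambda>p. fst p (snd p))"
  unfolding continuous_map
proof (intro conjI allI impI)
  show "(\<lambda>p. fst p (snd p)) ` topspace (prod_topology (path_space Z) unit_interval) \<subseteq> topspace Z"
    by (force simp: path_set_iff continuous_map_def)
  fix U assume U: "openin Z U"
  let ?S = "{p \<in> topspace (prod_topology (path_space Z) unit_interval). fst p (snd p) \<in> U}"
  show "openin (prod_topology (path_space Z) unit_interval) ?S"
  proof (subst openin_subopen, safe)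
    fix \<gamma> t assume "(\<gamma>, t) \<in> topspace (prod_topology (path_space Z) unit_interval)"
      and \<gamma>t: "fst (\<gamma>, t) (snd (\<gamma>, t)) \<in> U"
    then have \<gamma>: "\<gamma> \<in> path_set Z" and t: "t \<in> {0..1}"
      by auto
    have "openin unit_interval {u \<in> topspace unit_interval. \<gamma> u \<in> U}"
      by (rule openin_continuous_map_preimage[OF _ U]) (use \<gamma> in \<open>simp add: path_set_iff\<close>)
    then obtain e where e: "e > 0" "cball t e \<inter> {0..1} \<subseteq> {u \<in> {0..1}. \<gamma> u \<in> U}"
      using \<gamma>t t by (subst (asm) openin_contains_cball) auto
    let ?K = "cball t e \<inter> {0..1}"
    let ?N = "{\<gamma> \<in> path_set Z. \<gamma> ` ?K \<subseteq> U}"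
    have "compact ?K"
      by (rule compact_Int_closed) auto
    then have "openin (path_space Z) ?N"
      unfolding path_space_def using U by (intro topology_generated_by_Basis) blast
    moreover have "openin unit_interval (ball t e \<inter> {0..1})"
      by (metis Int_commute open_ball openin_open_Int)
    ultimately have "openin (prod_topology (path_space Z) unit_interval)
        (?N \<times> (ball t e \<inter> {0..1}))"
      by (simp add: openin_prod_Times_iff)
    moreover have "(\<gamma>, t) \<in> ?N \<times> (ball t e \<inter> {0..1})"
      using e \<gamma> t by auto
    moreover have "?N \<times> (ball t e \<inter> {0..1}) \<subseteq> ?S"
      by (auto simp: image_subset_iff)
    ultimately show "\<exists>T. openin (prod_topology (path_space Z) unit_interval) T \<and> (\<gamma>, t) \<in> T \<and> T \<subseteq> ?S"
      by blast
  qed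
qed

lemma continuous_map_uncurry:
  assumes "continuous_map X (path_space Z) c" "continuous_map X unit_interval r"
  shows "continuous_map X Z (\<lambda>x. c x (r x))"
  using continuous_map_compose[OF continuous_map_pairedI[OF assms] continuous_map_path_eval]
  by (simp add: o_def)

section \<open>Path families\<close>

text \<open>A homotopy from \<open>a\<close> to \<open>b\<close> with the space written before the
  interval, so that \<open>K x\<close> is the track of \<open>x\<close>. Values outside
  \<open>{0..1}\<close> are left free; \<open>restrict\<close> is applied only when a track becomes
  a point of \<open>path_space\<close>.\<close>

definition path_family ::
  "'a topology \<Rightarrow> 'b topology \<Rightarrow> ('a \<Rightarrow> real \<Rightarrow> 'b) \<Rightarrow> ('a \<Rightarrow> 'b) \<Rightarrow> ('a \<Rightarrow> 'b) \<Rightarrow> bool" where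
  "path_family X Z K a b \<longleftrightarrow>
     continuous_map (prod_topology X unit_interval) Z (\<lambda>p. K (fst p) (snd p)) \<and>
     (\<forall>x \<in> topspace X. K x 0 = a x \<and> K x 1 = b x)"

lemma path_family_continuous:
  assumes "path_family X Z K a b" "continuous_map S X k" "continuous_map S unit_interval r"
  shows "continuous_map S Z (\<lambda>y. K (k y) (r y))"
  using continuous_map_compose[OF continuous_map_pairedI[OF assms(2,3)],
      of Z "\<lambda>p. K (fst p) (snd p)"] assms(1)
  by (simp add: path_family_def o_def)

lemma path_family_ends:
  assumes "path_family X Z K a b" "x \<in> topspace X"
  shows "K x 0 = a x" "K x 1 = b x"
  using assms by (auto simp: path_family_def)

lemma path_family_continuous_ends:
  assumes "path_family X Z K a b"
  shows "continuous_map X Z a" "continuous_map X Z b"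
  using continuous_map_eq[OF path_family_continuous[OF assms continuous_map_id continuous_map_unit_const[of 0]]]
    continuous_map_eq[OF path_family_continuous[OF assms continuous_map_id continuous_map_unit_const[of 1]]]
    path_family_ends[OF assms]
  by simp_all

lemma continuous_map_proj:
  "continuous_map (prod_topology X Y) X fst"
  "continuous_map (prod_topology X Y) Y snd"
  "continuous_map (prod_topology (prod_topology X Y) Z) X (\<lambda>p. fst (fst p))"
  "continuous_map (prod_topology (prod_topology X Y) Z) Y (\<lambda>p. snd (fst p))"
  using continuous_map_compose[OF continuous_map_fst continuous_map_fst, of X Y Z]
    continuous_map_compose[OF continuous_map_fst continuous_map_snd, of X Y Z]
  by (auto simp: o_def continuous_map_fst continuous_map_snd)

lemma continuous_map_comp:
  "continuous_map Y Z g \<Longrightarrow> continuous_map X Y f \<Longrightarrow> continuous_map X Z (\<lambda>x. g (f x))"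
  using continuous_map_compose[of X Y f Z g] by (simp add: o_def)

lemma continuous_map_point:
  "continuous_map X Y f \<Longrightarrow> x \<in> topspace X \<Longrightarrow> f x \<in> topspace Y"
  by (auto simp: continuous_map_def)

lemma path_family_comp:
  assumes "path_family X Z K a b" "continuous_map S X k"
  shows "path_family S Z (\<lambda>x. K (k x)) (\<lambda>x. a (k x)) (\<lambda>x. b (k x))"
  using path_family_continuous[OF assms(1) continuous_map_comp[OF assms(2) continuous_map_fst] continuous_map_snd]
    path_family_ends[OF assms(1)] continuous_map_point[OF assms(2)]
  by (simp add: path_family_def)

lemma path_family_const:
  "continuous_map X Z f \<Longrightarrow> path_family X Z (\<lambda>x t. f x) f f"
  by (auto simp: path_family_def intro: continuous_map_comp continuous_map_fst)

lemma path_family_reverse: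
  assumes "path_family X Z K a b"
  shows "path_family X Z (\<lambda>x t. K x (1 - t)) b a"
  using path_family_continuous[OF assms continuous_map_fst continuous_map_unit_compl[OF continuous_map_snd]]
    path_family_ends[OF assms]
  by (auto simp: path_family_def)

definition path_join :: "(real \<Rightarrow> 'a) \<Rightarrow> (real \<Rightarrow> 'a) \<Rightarrow> real \<Rightarrow> 'a" where
  "path_join \<alpha> \<beta> t = (if t \<le> 1/2 then \<alpha> (2 * t) else \<beta> (2 * t - 1))"

lemma continuous_map_if_le:
  assumes "continuous_map X euclideanreal r" "continuous_map X Y f" "continuous_map X Y g"
    and "\<And>x. x \<in> topspace X \<Longrightarrow> r x = c \<Longrightarrow> f x = g x"
  shows "continuous_map X Y (\<lambda>x. if r x \<le> c then f x else g x)"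
  using assms by (intro continuous_map_cases_le continuous_map_from_subtopology) auto

lemma continuous_map_clamp:
  assumes "continuous_map X euclideanreal r"
  shows "continuous_map X unit_interval (\<lambda>x. max 0 (min 1 (r x)))"
  by (intro continuous_map_unit_interval continuous_map_real_max continuous_map_real_min assms) auto

lemma continuous_map_path_join:
  assumes \<alpha>: "path_family X Z \<alpha> a b" and \<beta>: "path_family X Z \<beta> b c"
    and k: "continuous_map S X k" and r: "continuous_map S unit_interval r"
  shows "continuous_map S Z (\<lambda>y. path_join (\<alpha> (k y)) (\<beta> (k y)) (r y))"
proof (rule continuous_map_eq)
  \<comment> \<open>The gluing lemma wants both branches continuous on all of \<open>S\<close>.
    Clamping extends each branch beyond its own half and changes nothing on that half.\<close>
  let ?u = "\<lambda>y. max 0 (min 1 (2 * r y))" and ?v = "\<lambda>y. max 0 (min 1 (2 * r y - 1))"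
  have r': "continuous_map S euclideanreal r"
    by (rule unit_interval_real[OF r])
  have "continuous_map S unit_interval ?u" "continuous_map S unit_interval ?v"
    by (intro continuous_map_clamp continuous_map_diff continuous_map_real_mult_left r'
        continuous_map_canonical_const)+
  then show "continuous_map S Z (\<lambda>y. if r y \<le> 1/2 then \<alpha> (k y) (?u y) else \<beta> (k y) (?v y))"
    using r' path_family_ends[OF \<alpha> continuous_map_point[OF k]] path_family_ends[OF \<beta> continuous_map_point[OF k]]
    by (intro continuous_map_if_le path_family_continuous[OF \<alpha> k] path_family_continuous[OF \<beta> k]) auto
  show "(if r y \<le> 1/2 then \<alpha> (k y) (?u y) else \<beta> (k y) (?v y)) = path_join (\<alpha> (k y)) (\<beta> (k y)) (r y)"
    if "y \<in> topspace S" for y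
    using unit_interval_range[OF r that] by (auto simp: path_join_def)
qed

lemma path_family_join:
  assumes \<alpha>: "path_family X Z \<alpha> a b" and \<beta>: "path_family X Z \<beta> b c"
  shows "path_family X Z (\<lambda>x. path_join (\<alpha> x) (\<beta> x)) a c"
  using continuous_map_path_join[OF \<alpha> \<beta> continuous_map_fst continuous_map_snd]
    path_family_ends[OF \<alpha>] path_family_ends[OF \<beta>]
  by (auto simp: path_family_def path_join_def)

section \<open>Homotopy pullbacks\<close>

lemma topspace_homotopy_pullback:
  "e \<in> topspace (homotopy_pullback X Y Z f g) \<longleftrightarrow>
     fst e \<in> topspace X \<and> fst (snd e) \<in> path_set Z \<and> snd (snd e) \<in> topspace Y \<and>
     fst (snd e) 0 = f (fst e) \<and> fst (snd e) 1 = g (snd (snd e))"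
  by (auto simp: homotopy_pullback_def mem_Times_iff)

lemma homotopy_pullback_eta:
  assumes "e \<in> topspace (homotopy_pullback X Y Z f g)"
  shows "(fst e, restrict (fst (snd e)) {0..1}, snd (snd e)) = e"
  using assms by (auto simp: topspace_homotopy_pullback path_set_iff extensional_restrict)

lemma homotopy_pullback_fst:
  "continuous_map (homotopy_pullback X Y Z f g) X fst"
  unfolding homotopy_pullback_def by (intro continuous_map_from_subtopology continuous_map_fst)

lemma homotopy_pullback_snd:
  "continuous_map (homotopy_pullback X Y Z f g) Y (\<lambda>e. snd (snd e))"
  unfolding homotopy_pullback_def
  by (rule continuous_map_from_subtopology[OF continuous_map_comp[OF continuous_map_snd continuous_map_snd]])

lemma homotopy_pullback_path:
  "path_family (homotopy_pullback X Y Z f g) Z (\<lambda>e. fst (snd e)) (\<lambda>e. f (fst e)) (\<lambda>e. g (snd (snd e)))"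
proof -
  let ?E = "homotopy_pullback X Y Z f g"
  have "continuous_map ?E (path_space Z) (\<lambda>e. fst (snd e))"
    unfolding homotopy_pullback_def
    by (rule continuous_map_from_subtopology[OF continuous_map_comp[OF continuous_map_fst continuous_map_snd]])
  from continuous_map_uncurry[OF continuous_map_comp[OF this continuous_map_fst] continuous_map_snd]
  show ?thesis
    by (auto simp: path_family_def topspace_homotopy_pullback)
qed

lemma continuous_map_homotopy_pullbackI:
  assumes "continuous_map S X a" "continuous_map S Y b"
    and c: "path_family S Z c (\<lambda>y. f (a y)) (\<lambda>y. g (b y))"
  shows "continuous_map S (homotopy_pullback X Y Z f g) (\<lambda>y. (a y, restrict (c y) {0..1}, b y))"
proof -
  have "continuous_map S (path_space Z) (\<lambda>y. restrict (c y) {0..1})"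
    using c by (intro continuous_map_curry) (simp add: path_family_def)
  then show ?thesis
    unfolding homotopy_pullback_def using assms(1,2) path_family_ends[OF c]
    by (intro continuous_map_into_subtopology continuous_map_pairedI) auto
qed

lemma homotopic_homotopy_pullbackI:
  assumes "continuous_map (prod_topology unit_interval T) X (\<lambda>p. a (fst p) (snd p))"
    and "continuous_map (prod_topology unit_interval T) Y (\<lambda>p. b (fst p) (snd p))"
    and "path_family (prod_topology unit_interval T) Z (\<lambda>p. c (fst p) (snd p))
           (\<lambda>p. f (a (fst p) (snd p))) (\<lambda>p. g (b (fst p) (snd p)))"
    and "\<And>x. x \<in> topspace T \<Longrightarrow> F x = (a 0 x, restrict (c 0 x) {0..1}, b 0 x)"
    and "\<And>x. x \<in> topspace T \<Longrightarrow> G x = (a 1 x, restrict (c 1 x) {0..1}, b 1 x)"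
  shows "homotopic T (homotopy_pullback X Y Z f g) F G"
  using continuous_map_homotopy_pullbackI[OF assms(1-3)] assms(4,5)
  by (intro homotopicI[where h = "\<lambda>s x. (a s x, restrict (c s x) {0..1}, b s x)"]) auto

text \<open>The map of homotopy pullbacks induced by \<open>\<xi>\<close> when
  \<open>f' \<circ> \<xi>\<close> agrees with \<open>f\<close> only up to the homotopy
  \<open>K\<close>: a path that starts at \<open>f x\<close> must be preceded by \<open>K x\<close>
  in order to start at \<open>f' (\<xi> x)\<close>.\<close>

definition pullback_shift ::
  "('a \<Rightarrow> 'b) \<Rightarrow> ('a \<Rightarrow> real \<Rightarrow> 'c) \<Rightarrow> 'a \<times> (real \<Rightarrow> 'c) \<times> 'd \<Rightarrow> 'b \<times> (real \<Rightarrow> 'c) \<times> 'd" where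
  "pullback_shift \<xi> K e =
     (\<xi> (fst e), restrict (path_join (K (fst e)) (fst (snd e))) {0..1}, snd (snd e))"

lemma path_family_shift:
  assumes "path_family X Z K (\<lambda>x. f' (\<xi> x)) f"
  shows "path_family (homotopy_pullback X Y Z f g) Z
     (\<lambda>e. path_join (K (fst e)) (fst (snd e))) (\<lambda>e. f' (\<xi> (fst e))) (\<lambda>e. g (snd (snd e)))"
  by (rule path_family_join[OF path_family_comp[OF assms homotopy_pullback_fst] homotopy_pullback_path])

lemma continuous_map_shift:
  assumes "continuous_map X X' \<xi>" "path_family X Z K (\<lambda>x. f' (\<xi> x)) f"
  shows "continuous_map (homotopy_pullback X Y Z f g) (homotopy_pullback X' Y Z f' g)
    (pullback_shift \<xi> K)"
  unfolding pullback_shift_def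
  by (intro continuous_map_homotopy_pullbackI continuous_map_comp[OF assms(1)]
      homotopy_pullback_fst homotopy_pullback_snd path_family_shift[of X Z K f' \<xi> f, OF assms(2)])

lemma homotopic_shift:
  assumes \<xi>: "continuous_map (prod_topology unit_interval X) X' (\<lambda>p. \<xi> (fst p) (snd p))"
    and K: "path_family (prod_topology unit_interval X) Z (\<lambda>p. K (fst p) (snd p))
      (\<lambda>p. f' (\<xi> (fst p) (snd p))) (\<lambda>p. f (snd p))"
    and ends: "\<And>x. x \<in> topspace X \<Longrightarrow> \<xi> 0 x = \<xi>0 x" "\<And>x. x \<in> topspace X \<Longrightarrow> \<xi> 1 x = \<xi>1 x"
      "\<And>x t. x \<in> topspace X \<Longrightarrow> t \<in> {0..1} \<Longrightarrow> K 0 x t = K0 x t"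
      "\<And>x t. x \<in> topspace X \<Longrightarrow> t \<in> {0..1} \<Longrightarrow> K 1 x t = K1 x t"
  shows "homotopic (homotopy_pullback X Y Z f g) (homotopy_pullback X' Y Z f' g)
    (pullback_shift \<xi>0 K0) (pullback_shift \<xi>1 K1)"
proof (rule homotopic_homotopy_pullbackI)
  let ?E = "homotopy_pullback X Y Z f g"
  have e: "continuous_map (prod_topology unit_interval ?E) ?E snd"
    by (rule continuous_map_snd)
  have k: "continuous_map (prod_topology unit_interval ?E) (prod_topology unit_interval X)
      (\<lambda>p. (fst p, fst (snd p)))"
    by (intro continuous_map_pairedI continuous_map_fst continuous_map_comp[OF homotopy_pullback_fst e])
  show "continuous_map (prod_topology unit_interval ?E) X' (\<lambda>p. \<xi> (fst p) (fst (snd p)))"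
    using continuous_map_comp[OF \<xi> k] by simp
  show "continuous_map (prod_topology unit_interval ?E) Y (\<lambda>p. snd (snd (snd p)))"
    by (rule continuous_map_comp[OF homotopy_pullback_snd e])
  show "path_family (prod_topology unit_interval ?E) Z
      (\<lambda>p. path_join (K (fst p) (fst (snd p))) (fst (snd (snd p))))
      (\<lambda>p. f' (\<xi> (fst p) (fst (snd p)))) (\<lambda>p. g (snd (snd (snd p))))"
    using path_family_join[OF path_family_comp[OF K k, simplified] path_family_comp[OF homotopy_pullback_path e]] .
  fix e assume "e \<in> topspace ?E"
  then have "fst e \<in> topspace X"
    by (simp add: topspace_homotopy_pullback)
  then show "pullback_shift \<xi>0 K0 e = (\<xi> 0 (fst e),
      restrict (path_join (K 0 (fst e)) (fst (snd e))) {0..1}, snd (snd e))"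
    "pullback_shift \<xi>1 K1 e = (\<xi> 1 (fst e),
      restrict (path_join (K 1 (fst e)) (fst (snd e))) {0..1}, snd (snd e))"
    using ends by (auto simp: pullback_shift_def path_join_def fun_eq_iff)
qed

text \<open>The interval is convex, so \<open>t\<close> can be moved to \<open>\<rho> t\<close>
  along a straight line; both ends stay fixed because \<open>\<rho>\<close> fixes them.\<close>

lemma path_family_reparam:
  assumes c: "path_family T Z c a b" and \<rho>: "continuous_map unit_interval unit_interval \<rho>"
    and ends: "\<rho> 0 = 0" "\<rho> 1 = 1"
  shows "path_family (prod_topology unit_interval T) Z
    (\<lambda>p t. c (snd p) ((1 - fst p) * t + fst p * \<rho> t)) (\<lambda>p. a (snd p)) (\<lambda>p. b (snd p))"
proof -
  have "continuous_map (prod_topology (prod_topology unit_interval T) unit_interval) unit_interval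
      (\<lambda>p. (1 - fst (fst p)) * snd p + fst (fst p) * \<rho> (snd p))"
    by (intro continuous_map_unit_convex continuous_map_proj continuous_map_comp[OF \<rho>])
  from path_family_continuous[OF c continuous_map_proj(4) this]
  show ?thesis
    using path_family_ends[OF c] by (auto simp: path_family_def ends)
qed

lemma homotopic_reparam:
  assumes a: "continuous_map T X a" and b: "continuous_map T Y b"
    and c: "path_family T Z c (\<lambda>x. f (a x)) (\<lambda>x. g (b x))"
    and \<rho>: "continuous_map unit_interval unit_interval \<rho>" "\<rho> 0 = 0" "\<rho> 1 = 1"
  shows "homotopic T (homotopy_pullback X Y Z f g)
    (\<lambda>x. (a x, restrict (c x) {0..1}, b x)) (\<lambda>x. (a x, \<lambda>t\<in>{0..1}. c x (\<rho> t), b x))"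
  by (rule homotopic_homotopy_pullbackI[OF continuous_map_comp[OF a continuous_map_snd]
        continuous_map_comp[OF b continuous_map_snd] path_family_reparam[OF c \<rho>]]) auto

text \<open>The two sides bracket the three paths \<open>K'\<close>, \<open>K\<close> and the given
  one differently, and concatenation is associative up to reparametrisation.\<close>

lemma homotopic_shift_shift:
  assumes \<xi>: "continuous_map X X' \<xi>" and K: "path_family X Z K (\<lambda>x. f' (\<xi> x)) f"
    and \<xi>': "continuous_map X' X'' \<xi>'" and K': "path_family X' Z K' (\<lambda>x. f'' (\<xi>' x)) f'"
  shows "homotopic (homotopy_pullback X Y Z f g) (homotopy_pullback X'' Y Z f'' g)
    (pullback_shift \<xi>' K' \<circ> pullback_shift \<xi> K)
    (pullback_shift (\<lambda>x. \<xi>' (\<xi> x)) (\<lambda>x. path_join (K' (\<xi> x)) (K x)))"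
proof -
  let ?E = "homotopy_pullback X Y Z f g"
  \<comment> \<open>One bracketing has its breaks at 1/4 and 1/2, the other at 1/2 and 3/4. The
    piecewise linear map matching them has slopes 2, 1 and 1/2; it is concave, hence the minimum of
    its three pieces.\<close>
  define \<rho> :: "real \<Rightarrow> real" where "\<rho> = (\<lambda>t. min (2 * t) (min (t + 1/4) ((t + 1) / 2)))"
  have \<rho>: "continuous_map unit_interval unit_interval \<rho>" "\<rho> 0 = 0" "\<rho> 1 = 1"
    by (auto simp: \<rho>_def min_le_iff_disj intro!: continuous_map_unit_interval continuous_on_min continuous_on_divide
        continuous_on_add continuous_on_mult_left)
  let ?c = "\<lambda>e. path_join (K' (\<xi> (fst e))) (path_join (K (fst e)) (fst (snd e)))"
  have \<xi>e: "continuous_map ?E X' (\<lambda>e. \<xi> (fst e))"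
    by (rule continuous_map_comp[OF \<xi> homotopy_pullback_fst])
  have c: "path_family ?E Z ?c (\<lambda>e. f'' (\<xi>' (\<xi> (fst e)))) (\<lambda>e. g (snd (snd e)))"
    by (rule path_family_join[OF path_family_comp[OF K' \<xi>e] path_family_shift[of X Z K f' \<xi> f, OF K]])
  have eq: "?c e (\<rho> t) =
      path_join (path_join (K' (\<xi> (fst e))) (K (fst e))) (fst (snd e)) t" if "t \<in> {0..1}" for e t
  proof -
    consider "t \<le> 1/4" | "1/4 < t" "t \<le> 1/2" | "1/2 < t"
      by linarith
    then show ?thesis
    proof cases
      case 1
      then have "\<rho> t = 2 * t" using that by (simp add: \<rho>_def)
      then show ?thesis using 1 by (simp add: path_join_def)
    next
      case 2
      then have "\<rho> t = t + 1/4" using that by (simp add: \<rho>_def)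
      then show ?thesis using 2 by (simp add: path_join_def field_simps)
    next
      case 3
      then have "\<rho> t = (t + 1) / 2" using that by (simp add: \<rho>_def)
      then show ?thesis using 3 by (simp add: path_join_def field_simps)
    qed
  qed
  have "homotopic ?E (homotopy_pullback X'' Y Z f'' g)
      (\<lambda>e. (\<xi>' (\<xi> (fst e)), restrict (?c e) {0..1}, snd (snd e)))
      (\<lambda>e. (\<xi>' (\<xi> (fst e)), \<lambda>t\<in>{0..1}. ?c e (\<rho> t), snd (snd e)))"
    by (rule homotopic_reparam[OF continuous_map_comp[OF \<xi>' \<xi>e] homotopy_pullback_snd c \<rho>])
  then show ?thesis
  proof (rule homotopic_with_eq)
    fix e assume "e \<in> topspace ?E"
    show "(pullback_shift \<xi>' K' \<circ> pullback_shift \<xi> K) e =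
        (\<xi>' (\<xi> (fst e)), restrict (?c e) {0..1}, snd (snd e))"
      by (auto simp: pullback_shift_def path_join_def fun_eq_iff)
    show "pullback_shift (\<lambda>x. \<xi>' (\<xi> x)) (\<lambda>x. path_join (K' (\<xi> x)) (K x)) e =
        (\<xi>' (\<xi> (fst e)), \<lambda>t\<in>{0..1}. ?c e (\<rho> t), snd (snd e))"
      using eq[of _ e] by (simp add: pullback_shift_def fun_eq_iff)
  qed auto
qed

lemma homotopic_shift_const:
  assumes f: "continuous_map X Z f"
  shows "homotopic (homotopy_pullback X Y Z f g) (homotopy_pullback X Y Z f g)
    (pullback_shift (\<lambda>x. x) (\<lambda>x t. f x)) id"
proof -
  let ?E = "homotopy_pullback X Y Z f g"
  \<comment> \<open>Preceding a path by a constant one means waiting at its start until 1/2 and then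
    running at double speed.\<close>
  define \<rho> :: "real \<Rightarrow> real" where "\<rho> = (\<lambda>t. max 0 (2 * t - 1))"
  have \<rho>: "continuous_map unit_interval unit_interval \<rho>" "\<rho> 0 = 0" "\<rho> 1 = 1"
    by (auto simp: \<rho>_def intro!: continuous_map_unit_interval continuous_on_max continuous_on_diff
        continuous_on_mult_left)
  have "homotopic ?E ?E
      (\<lambda>e. (fst e, restrict (fst (snd e)) {0..1}, snd (snd e)))
      (\<lambda>e. (fst e, \<lambda>t\<in>{0..1}. fst (snd e) (\<rho> t), snd (snd e)))"
    by (rule homotopic_reparam[OF homotopy_pullback_fst homotopy_pullback_snd homotopy_pullback_path \<rho>])
  then have "homotopic ?E ?E id (pullback_shift (\<lambda>x. x) (\<lambda>x t. f x))"
  proof (rule homotopic_with_eq)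
    fix e assume e: "e \<in> topspace ?E"
    show "id e = (fst e, restrict (fst (snd e)) {0..1}, snd (snd e))"
      using homotopy_pullback_eta[OF e] by simp
    show "pullback_shift (\<lambda>x. x) (\<lambda>x t. f x) e =
        (fst e, \<lambda>t\<in>{0..1}. fst (snd e) (\<rho> t), snd (snd e))"
      using e by (auto simp: pullback_shift_def path_join_def \<rho>_def fun_eq_iff topspace_homotopy_pullback)
  qed auto
  then show ?thesis
    by (rule homotopic_sym)
qed

lemma homotopic_shift_reverse:
  assumes L: "path_family X Z L f' f"
  shows "homotopic (homotopy_pullback X Y Z f g) (homotopy_pullback X Y Z f g)
    (pullback_shift (\<lambda>x. x) (\<lambda>x t. L x (1 - t)) \<circ> pullback_shift (\<lambda>x. x) L) id"
proof -
  let ?E = "homotopy_pullback X Y Z f g"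
  have id: "continuous_map X X (\<lambda>x. x)"
    using continuous_map_id by (simp add: id_def)
  have "homotopic ?E ?E
      (pullback_shift (\<lambda>x. x) (\<lambda>x t. L x (1 - t)) \<circ> pullback_shift (\<lambda>x. x) L)
      (pullback_shift (\<lambda>x. x) (\<lambda>x. path_join (\<lambda>t. L x (1 - t)) (L x)))"
    by (rule homotopic_shift_shift[OF id L id path_family_reverse[OF L]])
  \<comment> \<open>The reversed \<open>L\<close> followed by \<open>L\<close> is \<open>L\<close>
    at parameter \<open>\<bar>2 * t - 1\<bar>\<close>. Moving this parameter linearly to 1 contracts
    the detour to the point \<open>f x\<close> where it begins and ends.\<close>
  also have "homotopic ?E ?E \<dots> (pullback_shift (\<lambda>x. x) (\<lambda>x t. f x))"
  proof (rule homotopic_shift[where \<xi> = "\<lambda>s x. x"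
        and K = "\<lambda>s x t. L x ((1 - s) * \<bar>2 * t - 1\<bar> + s * 1)"])
    have abs: "continuous_map unit_interval unit_interval (\<lambda>t. \<bar>2 * t - 1\<bar>)"
      by (auto intro!: continuous_map_unit_interval continuous_on_rabs continuous_on_diff continuous_on_mult_left)
    have "continuous_map (prod_topology (prod_topology unit_interval X) unit_interval) unit_interval
        (\<lambda>p. (1 - fst (fst p)) * \<bar>2 * snd p - 1\<bar> + fst (fst p) * 1)"
      by (intro continuous_map_unit_convex continuous_map_proj continuous_map_comp[OF abs]
          continuous_map_unit_const) auto
    from path_family_continuous[OF L continuous_map_proj(4) this]
    show "path_family (prod_topology unit_interval X) Z
        (\<lambda>p t. L (snd p) ((1 - fst p) * \<bar>2 * t - 1\<bar> + fst p * 1)) (\<lambda>p. f (snd p)) (\<lambda>p. f (snd p))"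
      using path_family_ends[OF L] by (auto simp: path_family_def)
    show "L x ((1 - 0) * \<bar>2 * t - 1\<bar> + 0 * 1) = path_join (\<lambda>t. L x (1 - t)) (L x) t" for x t
      by (cases "t \<le> 1/2") (auto simp: path_join_def)
  qed (use path_family_ends[OF L] in \<open>auto simp: continuous_map_proj\<close>)
  also have "homotopic ?E ?E \<dots> id"
    by (rule homotopic_shift_const[OF path_family_continuous_ends(2)[OF L]])
  finally show ?thesis .
qed

lemma homotopy_equivalence_shift_id:
  assumes L: "path_family X Z L f' f"
  shows "homotopy_equivalence (homotopy_pullback X Y Z f g) (homotopy_pullback X Y Z f' g)
    (pullback_shift (\<lambda>x. x) L)"
proof (rule homotopy_equivalenceI2)
  have id: "continuous_map X X (\<lambda>x. x)"
    using continuous_map_id by (simp add: id_def)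
  note R = path_family_reverse[OF L]
  show "continuous_map (homotopy_pullback X Y Z f g) (homotopy_pullback X Y Z f' g)
      (pullback_shift (\<lambda>x. x) L)"
    by (rule continuous_map_shift[OF id L])
  show "continuous_map (homotopy_pullback X Y Z f' g) (homotopy_pullback X Y Z f g)
      (pullback_shift (\<lambda>x. x) (\<lambda>x t. L x (1 - t)))"
    by (rule continuous_map_shift[OF id R])
  then show "continuous_map (homotopy_pullback X Y Z f' g) (homotopy_pullback X Y Z f g)
      (pullback_shift (\<lambda>x. x) (\<lambda>x t. L x (1 - t)))" .
  show "homotopic (homotopy_pullback X Y Z f g) (homotopy_pullback X Y Z f g)
      (pullback_shift (\<lambda>x. x) (\<lambda>x t. L x (1 - t)) \<circ> pullback_shift (\<lambda>x. x) L) id"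
    by (rule homotopic_shift_reverse[OF L])
  show "homotopic (homotopy_pullback X Y Z f' g) (homotopy_pullback X Y Z f' g)
      (pullback_shift (\<lambda>x. x) L \<circ> pullback_shift (\<lambda>x. x) (\<lambda>x t. L x (1 - t))) id"
    using homotopic_shift_reverse[OF R] by simp
qed

text \<open>A homotopy from \<open>\<xi>\<close> to the identity replaces the shift by one along the
  identity with a loop \<open>?L x\<close> at \<open>f x\<close>. The loop may be essential, so the
  shift need not be homotopic to the identity; it is still invertible, by reversing the
  loop.\<close>

lemma homotopy_equivalence_shift_homotopic_id:
  assumes f: "continuous_map X Z f" and \<xi>: "homotopic X X \<xi> id"
    and Q: "path_family X Z Q (\<lambda>x. f (\<xi> x)) f"
  shows "homotopy_equivalence (homotopy_pullback X Y Z f g) (homotopy_pullback X Y Z f g)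
    (pullback_shift \<xi> Q)"
proof -
  let ?E = "homotopy_pullback X Y Z f g" and ?IX = "prod_topology unit_interval X"
  obtain N where N: "continuous_map ?IX X (\<lambda>p. N (fst p) (snd p))"
    and N01: "\<And>x. N 0 x = \<xi> x" "\<And>x. N 1 x = x"
    using \<xi> by (rule homotopicE) auto
  have N': "continuous_map S X (\<lambda>p. N (s p) (k p))"
    if "continuous_map S unit_interval s" "continuous_map S X k" for S s and k :: "'z \<Rightarrow> _"
    using continuous_map_comp[OF N continuous_map_pairedI[OF that]] by simp
  let ?L = "\<lambda>x. path_join (\<lambda>t. f (N (1 - t) x)) (Q x)"
  have \<rho>: "continuous_map unit_interval unit_interval (\<lambda>t. max 0 (2 * t - 1))"
    by (auto intro!: continuous_map_unit_interval continuous_on_max continuous_on_diff continuous_on_mult_left)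
  \<comment> \<open>A wait at \<open>f (\<xi> x)\<close> is put before \<open>Q\<close>. In the next
    homotopy it grows into the track from \<open>f (N s x)\<close> back to
    \<open>f (\<xi> x)\<close> while the base point moves along \<open>N\<close>.\<close>
  have "homotopic ?E ?E (pullback_shift \<xi> Q)
      (pullback_shift \<xi> (\<lambda>x. path_join (\<lambda>t. f (\<xi> x)) (Q x)))"
    by (rule homotopic_shift[where \<xi> = "\<lambda>s x. \<xi> x"
          and K = "\<lambda>s x t. Q x ((1 - s) * t + s * max 0 (2 * t - 1))"])
      (use path_family_reparam[OF Q \<rho>] path_family_ends[OF Q] \<xi> in
        \<open>auto simp: path_join_def intro: continuous_map_comp continuous_map_proj dest: homotopic_with_imp_continuous_maps\<close>)
  also have "homotopic ?E ?E \<dots> (pullback_shift (\<lambda>x. x) ?L)"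
  proof (rule homotopic_shift[where \<xi> = N
        and K = "\<lambda>s x. path_join (\<lambda>t. f (N (s * (1 - t)) x)) (Q x)"])
    have "continuous_map (prod_topology ?IX unit_interval) unit_interval
        (\<lambda>p. (1 - fst (fst p)) * 0 + fst (fst p) * (1 - snd p))"
      by (intro continuous_map_unit_convex continuous_map_proj continuous_map_unit_compl
          continuous_map_unit_const) auto
    from continuous_map_comp[OF f N'[OF this continuous_map_proj(4)]]
    have "path_family ?IX Z (\<lambda>p t. f (N (fst p * (1 - t)) (snd p)))
        (\<lambda>p. f (N (fst p) (snd p))) (\<lambda>p. f (\<xi> (snd p)))"
      by (auto simp: path_family_def N01)
    from path_family_join[OF this path_family_comp[OF Q continuous_map_snd]]
    show "path_family ?IX Z (\<lambda>p. path_join (\<lambda>t. f (N (fst p * (1 - t)) (snd p))) (Q (snd p)))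
        (\<lambda>p. f (N (fst p) (snd p))) (\<lambda>p. f (snd p))" .
  qed (auto simp: N N01)
  finally have "homotopic ?E ?E (pullback_shift (\<lambda>x. x) ?L) (pullback_shift \<xi> Q)"
    by (rule homotopic_sym)
  moreover have "path_family X Z ?L f f"
  proof (rule path_family_join[OF _ Q])
    show "path_family X Z (\<lambda>x t. f (N (1 - t) x)) f (\<lambda>x. f (\<xi> x))"
      using continuous_map_comp[OF f N'[OF continuous_map_unit_compl[OF continuous_map_snd] continuous_map_fst]]
      by (auto simp: path_family_def N01)
  qed
  ultimately show ?thesis
    using homotopy_equivalence_shift_id homotopy_equivalence_homotopic by blast
qed

text \<open>The two homotopies of a homotopy inverse need not be compatible with each other. Both
  composites of the shifts along \<open>\<xi>\<close> and \<open>\<eta>\<close> are shifts along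
  maps homotopic to the identity, and it suffices that these are equivalences.\<close>

lemma homotopy_equivalence_shift:
  assumes \<xi>: "homotopy_equivalence X X' \<xi>" and K: "path_family X Z K (\<lambda>x. f' (\<xi> x)) f"
    and f': "continuous_map X' Z f'"
  shows "homotopy_equivalence (homotopy_pullback X Y Z f g) (homotopy_pullback X' Y Z f' g)
    (pullback_shift \<xi> K)"
proof -
  obtain \<eta> where \<xi>c: "continuous_map X X' \<xi>" and \<eta>: "continuous_map X' X \<eta>"
    and \<eta>\<xi>: "homotopic X X (\<eta> \<circ> \<xi>) id" and \<xi>\<eta>: "homotopic X' X' (\<xi> \<circ> \<eta>) id"
    using \<xi> unfolding homotopy_equivalence_def by auto
  obtain N where N: "continuous_map (prod_topology unit_interval X') X' (\<lambda>p. N (fst p) (snd p))"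
    and N01: "\<And>x. N 0 x = \<xi> (\<eta> x)" "\<And>x. N 1 x = x"
    using \<xi>\<eta> by (rule homotopicE) auto
  \<comment> \<open>From \<open>f (\<eta> x)\<close> backwards along \<open>K\<close> to
    \<open>f' (\<xi> (\<eta> x))\<close>, then along \<open>N\<close> to
    \<open>f' x\<close>.\<close>
  let ?K' = "\<lambda>x. path_join (\<lambda>t. K (\<eta> x) (1 - t)) (\<lambda>t. f' (N t x))"
  have "path_family X' Z (\<lambda>x t. f' (N t x)) (\<lambda>x. f' (\<xi> (\<eta> x))) f'"
    using continuous_map_comp[OF f' continuous_map_comp[OF N
          continuous_map_pairedI[OF continuous_map_snd continuous_map_fst]]]
    by (auto simp: path_family_def N01)
  then have K': "path_family X' Z ?K' (\<lambda>x. f (\<eta> x)) f'"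
    using path_family_join[OF path_family_comp[OF path_family_reverse[OF K] \<eta>]] by blast
  have f: "continuous_map X Z f"
    by (rule path_family_continuous_ends(2)[OF K])
  show ?thesis
  proof (rule homotopy_equivalence_if_compositions)
    let ?A = "pullback_shift \<xi> K :: _ \<Rightarrow> _ \<times> _ \<times> 'd" and ?B = "pullback_shift \<eta> ?K' :: _ \<Rightarrow> _ \<times> _ \<times> 'd"
    let ?E = "homotopy_pullback X Y Z f g" and ?E' = "homotopy_pullback X' Y Z f' g"
    show "continuous_map ?E ?E' ?A"
      by (rule continuous_map_shift[OF \<xi>c K])
    show "continuous_map ?E' ?E ?B"
      by (rule continuous_map_shift[OF \<eta> K'])
    show "homotopy_equivalence ?E ?E (?B \<circ> ?A)"
      using \<eta>\<xi> by (intro homotopy_equivalence_homotopic[OF homotopy_equivalence_shift_homotopic_id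
            homotopic_sym[OF homotopic_shift_shift[of X X' \<xi> Z K f' f X \<eta> ?K' f]]] f \<xi>c K \<eta> K'
          path_family_join[OF path_family_comp[OF K' \<xi>c] K]) (simp add: o_def)
    show "homotopy_equivalence ?E' ?E' (?A \<circ> ?B)"
      using \<xi>\<eta> by (intro homotopy_equivalence_homotopic[OF homotopy_equivalence_shift_homotopic_id
            homotopic_sym[OF homotopic_shift_shift[of X' X \<eta> Z ?K' f f' X' \<xi> K f']]] f' \<xi>c K \<eta> K'
          path_family_join[OF path_family_comp[OF K \<eta>] K']) (simp add: o_def)
  qed
qed

section \<open>Exchanging the two legs of a homotopy pullback\<close>

definition pullback_swap :: "'a \<times> (real \<Rightarrow> 'c) \<times> 'b \<Rightarrow> 'b \<times> (real \<Rightarrow> 'c) \<times> 'a" where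
  "pullback_swap e = (snd (snd e), \<lambda>t\<in>{0..1}. fst (snd e) (1 - t), fst e)"

lemma continuous_map_swap:
  "continuous_map (homotopy_pullback X Y Z f g) (homotopy_pullback Y X Z g f) pullback_swap"
  unfolding pullback_swap_def
  by (intro continuous_map_homotopy_pullbackI homotopy_pullback_fst homotopy_pullback_snd
      path_family_reverse[OF homotopy_pullback_path])

lemma pullback_swap_swap:
  assumes "e \<in> topspace (homotopy_pullback X Y Z f g)"
  shows "pullback_swap (pullback_swap e) = e"
proof -
  have "restrict (\<lambda>t. (\<lambda>t\<in>{0..1}. fst (snd e) (1 - t)) (1 - t)) {0..1} = restrict (fst (snd e)) {0..1}"
    by (auto simp: fun_eq_iff)
  then show ?thesis
    using homotopy_pullback_eta[OF assms] by (simp add: pullback_swap_def)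
qed

lemma homotopy_equivalence_swap:
  "homotopy_equivalence (homotopy_pullback X Y Z f g) (homotopy_pullback Y X Z g f) pullback_swap"
  by (rule homotopy_equivalence_inverse[OF continuous_map_swap continuous_map_swap])
    (erule pullback_swap_swap)+

lemma homotopy_equivalence_pullback_snd:
  assumes \<phi>: "homotopy_equivalence Y Y' \<phi>" and g': "continuous_map Y' Z g'"
  shows "homotopy_equivalence (homotopy_pullback X Y Z f (\<lambda>y. g' (\<phi> y))) (homotopy_pullback X Y' Z f g')
    (\<lambda>e. (fst e, restrict (fst (snd e)) {0..1}, \<phi> (snd (snd e))))"
proof -
  let ?E = "homotopy_pullback X Y Z f (\<lambda>y. g' (\<phi> y))" and ?E' = "homotopy_pullback X Y' Z f g'"
  let ?S = "pullback_shift \<phi> (\<lambda>y t. g' (\<phi> y))"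
  \<comment> \<open>Between two swaps the constant path of the shift ends up behind the given path,
    so the result runs at double speed and then waits.\<close>
  define \<rho> :: "real \<Rightarrow> real" where "\<rho> = (\<lambda>t. min 1 (2 * t))"
  have \<rho>: "continuous_map unit_interval unit_interval \<rho>" "\<rho> 0 = 0" "\<rho> 1 = 1"
    by (auto simp: \<rho>_def intro!: continuous_map_unit_interval continuous_on_min continuous_on_mult_left)
  have \<phi>c: "continuous_map Y Y' \<phi>"
    using \<phi> by (simp add: homotopy_equivalence_def)
  have "homotopy_equivalence (homotopy_pullback Y X Z (\<lambda>y. g' (\<phi> y)) f) (homotopy_pullback Y' X Z g' f) ?S"
    by (intro homotopy_equivalence_shift \<phi> g' path_family_const continuous_map_comp[OF g' \<phi>c])
  then have "homotopy_equivalence ?E ?E' (pullback_swap \<circ> (?S \<circ> pullback_swap))"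
    using homotopy_equivalence_compose[OF homotopy_equivalence_compose[OF homotopy_equivalence_swap]
        homotopy_equivalence_swap] by blast
  moreover have "homotopic ?E ?E' (\<lambda>e. (fst e, restrict (fst (snd e)) {0..1}, \<phi> (snd (snd e))))
      (pullback_swap \<circ> (?S \<circ> pullback_swap))"
  proof (rule homotopic_with_eq[OF homotopic_reparam[OF homotopy_pullback_fst
          continuous_map_comp[OF \<phi>c homotopy_pullback_snd] homotopy_pullback_path \<rho>]])
    fix e assume "e \<in> topspace ?E"
    then show "(pullback_swap \<circ> (?S \<circ> pullback_swap)) e =
        (fst e, \<lambda>t\<in>{0..1}. fst (snd e) (\<rho> t), \<phi> (snd (snd e)))"
      by (auto simp: pullback_swap_def pullback_shift_def path_join_def \<rho>_def fun_eq_iff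
          topspace_homotopy_pullback min_def)
  qed auto
  ultimately show ?thesis
    using homotopy_equivalence_homotopic homotopic_sym by blast
qed

section \<open>Pasting of homotopy pullbacks\<close>

text \<open>The comparison map of pasting: \<open>f\<close> carries a path of the middle base to the
  last base, where the homotopy \<open>H\<close> filling the right square continues it.\<close>

definition pullback_paste ::
  "('b \<Rightarrow> 'c) \<Rightarrow> ('p \<Rightarrow> real \<Rightarrow> 'c) \<Rightarrow> ('p \<Rightarrow> 'y) \<Rightarrow> 'w \<times> (real \<Rightarrow> 'b) \<times> 'p \<Rightarrow> 'w \<times> (real \<Rightarrow> 'c) \<times> 'y" where
  "pullback_paste f H q e =
     (fst e, restrict (path_join (\<lambda>t. f (fst (snd e) t)) (H (snd (snd e)))) {0..1}, q (snd (snd e)))"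

lemma path_family_map:
  "path_family T X c a b \<Longrightarrow> continuous_map X Z f \<Longrightarrow>
     path_family T Z (\<lambda>x t. f (c x t)) (\<lambda>x. f (a x)) (\<lambda>x. f (b x))"
  by (auto simp: path_family_def intro: continuous_map_comp)

lemma path_family_paste:
  assumes f: "continuous_map X Z f" and H: "path_family P Z H (\<lambda>z. f (p z)) (\<lambda>z. g (q z))"
  shows "path_family (homotopy_pullback W P X u p) Z
    (\<lambda>e. path_join (\<lambda>t. f (fst (snd e) t)) (H (snd (snd e))))
    (\<lambda>e. f (u (fst e))) (\<lambda>e. g (q (snd (snd e))))"
  by (rule path_family_join[OF path_family_map[OF homotopy_pullback_path f]
        path_family_comp[OF H homotopy_pullback_snd]])

lemma continuous_map_paste:
  assumes f: "continuous_map X Z f" and q: "continuous_map P Y q"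
    and H: "path_family P Z H (\<lambda>z. f (p z)) (\<lambda>z. g (q z))"
  shows "continuous_map (homotopy_pullback W P X u p) (homotopy_pullback W Y Z (\<lambda>w. f (u w)) g)
    (pullback_paste f H q)"
  unfolding pullback_paste_def
  by (rule continuous_map_homotopy_pullbackI[OF homotopy_pullback_fst
        continuous_map_comp[OF q homotopy_pullback_snd] path_family_paste[of X Z f P H p g q W u, OF f H]])

text \<open>The point of \<open>X\<close> in the iterated pullback is redundant, because a path
  joins it to \<open>u w\<close> and it can be slid back along that path. The inverse
  \<open>?d\<close> accordingly chooses \<open>u w\<close> itself with the constant path.\<close>

lemma homotopy_equivalence_paste_canonical:
  assumes f: "continuous_map X Z f" and u: "continuous_map W X u"
  shows "homotopy_equivalence
    (homotopy_pullback W (homotopy_pullback X Y Z f g) X u fst)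
    (homotopy_pullback W Y Z (\<lambda>w. f (u w)) g)
    (pullback_paste f (\<lambda>z. fst (snd z)) (\<lambda>z. snd (snd z)))"
proof (rule homotopy_equivalenceI2)
  let ?P = "homotopy_pullback X Y Z f g"
  let ?A = "homotopy_pullback W ?P X u fst" and ?B = "homotopy_pullback W Y Z (\<lambda>w. f (u w)) g"
  let ?c = "pullback_paste f (\<lambda>z. fst (snd z)) (\<lambda>z. snd (snd z)) ::
    'c \<times> (real \<Rightarrow> 'a) \<times> 'a \<times> (real \<Rightarrow> 'b) \<times> 'd \<Rightarrow> 'c \<times> (real \<Rightarrow> 'b) \<times> 'd"
  let ?d = "\<lambda>e. (fst e, \<lambda>t\<in>{0..1}. u (fst e), (u (fst e), restrict (fst (snd e)) {0..1}, snd (snd e)))"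
  show c: "continuous_map ?A ?B ?c"
    by (rule continuous_map_paste[OF f homotopy_pullback_snd homotopy_pullback_path])
  have ue: "continuous_map ?B X (\<lambda>e. u (fst e))"
    by (rule continuous_map_comp[OF u homotopy_pullback_fst])
  show "continuous_map ?B ?A ?d"
    by (intro continuous_map_homotopy_pullbackI homotopy_pullback_fst homotopy_pullback_snd ue
        homotopy_pullback_path) (simp add: path_family_const[OF ue])
  then show "continuous_map ?B ?A ?d" .
  have "homotopic ?B ?B (pullback_shift (\<lambda>x. x) (\<lambda>w t. f (u w))) id"
    by (rule homotopic_shift_const[OF continuous_map_comp[OF f u]])
  then show "homotopic ?B ?B (?c \<circ> ?d) id"
    by (rule homotopic_with_eq) (auto simp: pullback_paste_def pullback_shift_def path_join_def fun_eq_iff)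
  define T where "T = prod_topology unit_interval ?A"
  have e: "continuous_map T ?A snd"
    unfolding T_def by (rule continuous_map_snd)
  have z: "continuous_map T ?P (\<lambda>p. snd (snd (snd p)))"
    by (rule continuous_map_comp[OF homotopy_pullback_snd e])
  have zA: "continuous_map ?A ?P (\<lambda>e. snd (snd e))"
    by (rule homotopy_pullback_snd)
  define \<rho> :: "real \<Rightarrow> real" where "\<rho> = (\<lambda>t. max 0 (2 * t - 1))"
  have \<rho>: "continuous_map unit_interval unit_interval \<rho>" "\<rho> 0 = 0" "\<rho> 1 = 1"
    by (auto simp: \<rho>_def intro!: continuous_map_unit_interval continuous_on_max continuous_on_diff
        continuous_on_mult_left)
  note \<alpha> = path_family_comp[OF homotopy_pullback_path e]
  note \<gamma>A = path_family_comp[OF homotopy_pullback_path zA]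
  \<comment> \<open>The inner path is first delayed by a wait on \<open>[0, 1/2]\<close>, because
    the slide below ends with an inner path of this form.\<close>
  have "homotopic ?A ?A (\<lambda>e. (fst e, restrict (fst (snd e)) {0..1},
        (fst (snd (snd e)), \<lambda>t\<in>{0..1}. fst (snd (snd (snd e))) ((1 - 0) * t + 0 * \<rho> t), snd (snd (snd (snd e))))))
      (\<lambda>e. (fst e, restrict (fst (snd e)) {0..1},
        (fst (snd (snd e)), \<lambda>t\<in>{0..1}. fst (snd (snd (snd e))) ((1 - 1) * t + 1 * \<rho> t), snd (snd (snd (snd e))))))"
    (is "homotopic _ _ ?h0 ?h1")
  proof (rule homotopic_homotopy_pullbackI[where a = "\<lambda>s e. fst e" and c = "\<lambda>s e. fst (snd e)"
        and b = "\<lambda>s e. (fst (snd (snd e)), \<lambda>t\<in>{0..1}. fst (snd (snd (snd e))) ((1 - s) * t + s * \<rho> t),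
          snd (snd (snd (snd e))))"], fold T_def)
    show "continuous_map T W (\<lambda>p. fst (snd p))"
      by (rule continuous_map_comp[OF homotopy_pullback_fst e])
    show "continuous_map T ?P (\<lambda>p. (fst (snd (snd (snd p))),
        \<lambda>t\<in>{0..1}. fst (snd (snd (snd (snd p)))) ((1 - fst p) * t + fst p * \<rho> t),
        snd (snd (snd (snd (snd p))))))"
      using path_family_reparam[OF \<gamma>A \<rho>] unfolding T_def[symmetric]
      by (rule continuous_map_homotopy_pullbackI[OF continuous_map_comp[OF homotopy_pullback_fst z]
            continuous_map_comp[OF homotopy_pullback_snd z]])
    show "path_family T X (\<lambda>p. fst (snd (snd p))) (\<lambda>p. u (fst (snd p)))
        (\<lambda>p. fst (fst (snd (snd (snd p))), \<lambda>t\<in>{0..1}. fst (snd (snd (snd (snd p)))) ((1 - fst p) * t + fst p * \<rho> t),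
        snd (snd (snd (snd (snd p))))))"
      using \<alpha> by simp
  qed auto
  then have "homotopic ?A ?A id ?h1"
  proof (rule homotopic_with_eq)
    fix e assume e: "e \<in> topspace ?A"
    then have "snd (snd e) \<in> topspace ?P"
      by (simp add: topspace_homotopy_pullback)
    from homotopy_pullback_eta[OF this] homotopy_pullback_eta[OF e]
    show "id e = ?h0 e"
      by simp
  qed auto
  \<comment> \<open>At stage \<open>s\<close> the inner point is the outer path at \<open>s\<close>.
    The part of the outer path before \<open>s\<close> is kept, and the part after \<open>s\<close>
    is carried by \<open>f\<close> into the inner path. Stage 0 is \<open>?d \<circ> ?c\<close>, and
    stage 1 is the delayed identity \<open>?h1\<close>.\<close>
  also have "homotopic ?A ?A ?h1 (?d \<circ> ?c)"
  proof (rule homotopic_sym, rule homotopic_homotopy_pullbackI[where a = "\<lambda>s e. fst e"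
        and c = "\<lambda>s e t. fst (snd e) (s * t)"
        and b = "\<lambda>s e. (fst (snd e) s,
          restrict (path_join (\<lambda>t. f (fst (snd e) ((1 - s) * t + s * 1))) (fst (snd (snd (snd e))))) {0..1},
          snd (snd (snd (snd e))))"], fold T_def)
    show "continuous_map T W (\<lambda>p. fst (snd p))"
      by (rule continuous_map_comp[OF homotopy_pullback_fst e])
    have s: "continuous_map T unit_interval fst"
      unfolding T_def by (rule continuous_map_fst)
    have \<alpha>s: "continuous_map T X (\<lambda>p. fst (snd (snd p)) (fst p))"
      by (rule path_family_continuous[OF homotopy_pullback_path e s])
    have "continuous_map (prod_topology T unit_interval) unit_interval
        (\<lambda>p. (1 - fst (fst p)) * snd p + fst (fst p) * 1)"
      by (intro continuous_map_unit_convex continuous_map_comp[OF s] continuous_map_fst continuous_map_snd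
          continuous_map_unit_const) auto
    from path_family_continuous[OF \<alpha> continuous_map_fst this]
    have "path_family T X (\<lambda>p t. fst (snd (snd p)) ((1 - fst p) * t + fst p * 1))
        (\<lambda>p. fst (snd (snd p)) (fst p)) (\<lambda>p. fst (snd (snd (snd p))))"
      using path_family_ends[OF \<alpha>] by (auto simp: path_family_def)
    from path_family_join[OF path_family_map[OF this f] path_family_comp[OF homotopy_pullback_path z]]
    show "continuous_map T ?P (\<lambda>p. (fst (snd (snd p)) (fst p),
        restrict (path_join (\<lambda>t. f (fst (snd (snd p)) ((1 - fst p) * t + fst p * 1)))
          (fst (snd (snd (snd (snd p)))))) {0..1},
        snd (snd (snd (snd (snd p))))))"
      by (rule continuous_map_homotopy_pullbackI[OF \<alpha>s continuous_map_comp[OF homotopy_pullback_snd z]])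
    have "continuous_map (prod_topology T unit_interval) unit_interval
        (\<lambda>p. (1 - fst (fst p)) * 0 + fst (fst p) * snd p)"
      by (intro continuous_map_unit_convex continuous_map_comp[OF s] continuous_map_fst continuous_map_snd
          continuous_map_unit_const) auto
    from path_family_continuous[OF \<alpha> continuous_map_fst this]
    show "path_family T X (\<lambda>p t. fst (snd (snd p)) (fst p * t)) (\<lambda>p. u (fst (snd p)))
        (\<lambda>p. fst (fst (snd (snd p)) (fst p),
        restrict (path_join (\<lambda>t. f (fst (snd (snd p)) ((1 - fst p) * t + fst p * 1)))
          (fst (snd (snd (snd (snd p)))))) {0..1},
        snd (snd (snd (snd (snd p))))))"
      using path_family_ends[OF \<alpha>] by (auto simp: path_family_def)
    fix e assume e: "e \<in> topspace ?A"
    then show "(?d \<circ> ?c) e = (fst e, \<lambda>t\<in>{0..1}. fst (snd e) (0 * t), (fst (snd e) 0,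
          restrict (path_join (\<lambda>t. f (fst (snd e) ((1 - 0) * t + 0 * 1))) (fst (snd (snd (snd e))))) {0..1},
          snd (snd (snd (snd e)))))"
      by (auto simp: pullback_paste_def topspace_homotopy_pullback fun_eq_iff)
    show "?h1 e = (fst e, \<lambda>t\<in>{0..1}. fst (snd e) (1 * t), (fst (snd e) 1,
          restrict (path_join (\<lambda>t. f (fst (snd e) ((1 - 1) * t + 1 * 1))) (fst (snd (snd (snd e))))) {0..1},
          snd (snd (snd (snd e)))))"
      using e by (auto simp: \<rho>_def path_join_def topspace_homotopy_pullback fun_eq_iff)
  qed
  finally show "homotopic ?A ?A (?d \<circ> ?c) id"
    by (rule homotopic_sym)
qed

text \<open>By \<open>he\<close> the space \<open>P\<close> may be exchanged for the homotopy
  pullback in the right leg, which leaves the canonical case.\<close>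

lemma homotopy_equivalence_paste:
  assumes f: "continuous_map X Z f" and u: "continuous_map W X u" and q: "continuous_map P Y q"
    and H: "path_family P Z H (\<lambda>z. f (p z)) (\<lambda>z. g (q z))"
    and he: "homotopy_equivalence P (homotopy_pullback X Y Z f g) (\<lambda>z. (p z, restrict (H z) {0..1}, q z))"
  shows "homotopy_equivalence (homotopy_pullback W P X u p) (homotopy_pullback W Y Z (\<lambda>w. f (u w)) g)
    (pullback_paste f H q)"
proof -
  let ?\<phi> = "\<lambda>e. (fst e, restrict (fst (snd e)) {0..1},
    (p (snd (snd e)), restrict (H (snd (snd e))) {0..1}, q (snd (snd e))))"
  have "homotopy_equivalence (homotopy_pullback W P X u p)
      (homotopy_pullback W (homotopy_pullback X Y Z f g) X u fst) ?\<phi>"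
    using homotopy_equivalence_pullback_snd[OF he homotopy_pullback_fst] by simp
  from homotopy_equivalence_compose[OF this homotopy_equivalence_paste_canonical[OF f u]]
  show ?thesis
    by (rule homotopy_equivalence_cong) (auto simp: pullback_paste_def path_join_def fun_eq_iff)
qed

section \<open>Squares in a homotopy coherent presheaf\<close>

lemma chain_simps [simp]:
  "chain C [f] \<longleftrightarrow> f \<in> Arr C"
  "chain C (f # g # fs) \<longleftrightarrow> f \<in> Arr C \<and> Cod C f = Dom C g \<and> chain C (g # fs)"
  by (auto simp: chain_def)

lemma inf_presheaf_continuous:
  assumes "inf_presheaf C A" "chain C fs"
  shows "continuous_map
    (prod_topology (cube (length fs - 1)) (space_at A (Cod C (last fs))))
    (space_at A (Dom C (hd fs)))
    (\<lambda>(t, a). act A fs (map t [0..<length fs - 1]) a)"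
  using assms by (simp add: inf_presheaf_def)

lemma inf_presheaf_composition:
  assumes A: "inf_presheaf C A" and "us \<noteq> []" "vs \<noteq> []" "chain C (us @ vs)"
    "cube_point us ps" "cube_point vs qs" "a \<in> topspace (space_at A (Cod C (last vs)))"
  shows "act A (us @ vs) (ps @ 1 # qs) a = act A us ps (act A vs qs a)"
  by (rule A[unfolded inf_presheaf_def, THEN conjunct2, THEN conjunct2, THEN conjunct1, rule_format,
        OF assms(2-)])

lemma inf_presheaf_face:
  assumes A: "inf_presheaf C A" and "chain C (us @ f # g # vs)"
    "cube_point (us @ f # g # vs) (ps @ 0 # qs)" "length ps = length us"
    "a \<in> topspace (space_at A (Cod C (last (g # vs))))"
  shows "act A (us @ f # g # vs) (ps @ 0 # qs) a = act A (us @ Cmp C g f # vs) (ps @ qs) a"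
  by (rule A[unfolded inf_presheaf_def, THEN conjunct2, THEN conjunct2, THEN conjunct2, THEN conjunct1,
        rule_format, OF assms(2-)])

lemma inf_presheaf_ident:
  assumes "inf_presheaf C A" "x \<in> Obj C" "a \<in> topspace (space_at A x)"
  shows "act A [Ident C x] [] a = a"
  using assms by (simp add: inf_presheaf_def)

text \<open>The record \<open>category\<close> carries no axioms, so the laws used in composing
  squares have to be stated and then checked for \<open>Delta\<close> and \<open>Xi\<close>.\<close>

definition composable :: "('o, 'm) category \<Rightarrow> bool" where
  "composable C \<longleftrightarrow>
     (\<forall>f g. f \<in> Arr C \<longrightarrow> g \<in> Arr C \<longrightarrow> Cod C f = Dom C g \<longrightarrow>
        Cmp C g f \<in> Arr C \<and> Dom C (Cmp C g f) = Dom C f \<and> Cod C (Cmp C g f) = Cod C g) \<and>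
     (\<forall>f g h. f \<in> Arr C \<longrightarrow> g \<in> Arr C \<longrightarrow> h \<in> Arr C \<longrightarrow>
        Cod C f = Dom C g \<longrightarrow> Cod C g = Dom C h \<longrightarrow>
        Cmp C h (Cmp C g f) = Cmp C (Cmp C h g) f)"

lemma composableD:
  assumes "composable C" "f \<in> Arr C" "g \<in> Arr C" "Cod C f = Dom C g"
  shows "Cmp C g f \<in> Arr C" "Dom C (Cmp C g f) = Dom C f" "Cod C (Cmp C g f) = Cod C g"
    and "h \<in> Arr C \<Longrightarrow> Cod C g = Dom C h \<Longrightarrow> Cmp C h (Cmp C g f) = Cmp C (Cmp C h g) f"
  using assms by (auto simp: composable_def)

lemma comm_square_paste:
  assumes C: "composable C" and sq1: "comm_square C f1 h1 g1 k1" and sq2: "comm_square C f2 g1 g2 k2"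
  shows "comm_square C (Cmp C f1 f2) h1 g2 (Cmp C k1 k2)"
proof -
  note sq = sq1[unfolded comm_square_def] sq2[unfolded comm_square_def]
  have "Cmp C h1 (Cmp C f1 f2) = Cmp C (Cmp C h1 f1) f2"
    using sq by (intro composableD(4)[OF C]) auto
  also have "\<dots> = Cmp C (Cmp C k1 g1) f2"
    using sq by simp
  also have "\<dots> = Cmp C k1 (Cmp C g1 f2)"
    using sq by (intro composableD(4)[OF C, symmetric]) auto
  also have "\<dots> = Cmp C k1 (Cmp C k2 g2)"
    using sq by simp
  also have "\<dots> = Cmp C (Cmp C k1 k2) g2"
    using sq by (intro composableD(4)[OF C]) auto
  finally show ?thesis
    using sq composableD(1-3)[OF C, of f2 f1] composableD(1-3)[OF C, of k2 k1]
    by (simp add: comm_square_def)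
qed

section \<open>Continuity and faces of the cubes attached to chains\<close>

lemma act_continuous:
  assumes A: "inf_presheaf C A" and c: "chain C fs"
    and \<tau>: "\<And>i. i < length fs - 1 \<Longrightarrow> continuous_map S unit_interval (\<lambda>y. \<tau> y i)"
    and k: "continuous_map S (space_at A (Cod C (last fs))) k"
  shows "continuous_map S (space_at A (Dom C (hd fs))) (\<lambda>y. act A fs (map (\<tau> y) [0..<length fs - 1]) (k y))"
proof -
  have "continuous_map S (cube (length fs - 1)) (\<lambda>y. \<lambda>i\<in>{..<length fs - 1}. \<tau> y i)"
    unfolding cube_def using \<tau> by (intro continuous_map_coordinatewise_then_product) auto
  from continuous_map_comp[OF inf_presheaf_continuous[OF A c] continuous_map_pairedI[OF this k]]
  show ?thesis
    by (rule continuous_map_eq) (auto intro!: arg_cong[where f = "\<lambda>ts. act A fs ts _"])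
qed

lemma act1_continuous:
  assumes "inf_presheaf C A" "f \<in> Arr C"
  shows "continuous_map (space_at A (Cod C f)) (space_at A (Dom C f)) (act A [f] [])"
  using act_continuous[OF assms(1), of "[f]" "space_at A (Cod C f)" _ "\<lambda>a. a"] assms(2)
    continuous_map_id[of "space_at A (Cod C f)"]
  by (simp add: id_def)

lemma act2_continuous:
  assumes "inf_presheaf C A" "chain C [f, g]"
    and "continuous_map S unit_interval s" "continuous_map S (space_at A (Cod C g)) k"
  shows "continuous_map S (space_at A (Dom C f)) (\<lambda>y. act A [f, g] [s y] (k y))"
  using act_continuous[OF assms(1,2), of S "\<lambda>y i. s y" k] assms(3,4) by simp

lemma act3_continuous:
  assumes "inf_presheaf C A" "chain C [f, g, h]"
    and "continuous_map S unit_interval s" "continuous_map S unit_interval t"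
    and "continuous_map S (space_at A (Cod C h)) k"
  shows "continuous_map S (space_at A (Dom C f)) (\<lambda>y. act A [f, g, h] [s y, t y] (k y))"
  using act_continuous[OF assms(1,2), of S "\<lambda>y i. if i = 0 then s y else t y" k] assms(3-)
  by (simp add: less_2_cases_iff upt_rec del: chain_simps)

lemma act2_ends:
  assumes A: "inf_presheaf C A" and c: "chain C [f, g]" and a: "a \<in> topspace (space_at A (Cod C g))"
  shows "act A [f, g] [0] a = act A [Cmp C g f] [] a"
    and "act A [f, g] [1] a = act A [f] [] (act A [g] [] a)"
  using inf_presheaf_face[OF A, of "[]" f g "[]" "[]" "[]" a]
    inf_presheaf_composition[OF A, of "[f]" "[g]" "[]" "[]" a] c a
  by (auto simp: cube_point_def)

text \<open>The four edges of the square that fills a chain of three arrows. All homotopies between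
  comparison maps below are assembled from such squares along these edges.\<close>

lemma act3_faces:
  assumes A: "inf_presheaf C A" and c: "chain C [f, g, h]" and a: "a \<in> topspace (space_at A (Cod C h))"
    and t: "0 \<le> t" "t \<le> 1"
  shows "act A [f, g, h] [0, t] a = act A [Cmp C g f, h] [t] a"
    and "act A [f, g, h] [t, 0] a = act A [f, Cmp C h g] [t] a"
    and "act A [f, g, h] [1, t] a = act A [f] [] (act A [g, h] [t] a)"
    and "act A [f, g, h] [t, 1] a = act A [f, g] [t] (act A [h] [] a)"
  using inf_presheaf_face[OF A, of "[]" f g "[h]" "[]" "[t]" a]
    inf_presheaf_face[OF A, of "[f]" g h "[]" "[t]" "[]" a]
    inf_presheaf_composition[OF A, of "[f]" "[g, h]" "[]" "[t]" a]
    inf_presheaf_composition[OF A, of "[f, g]" "[h]" "[t]" "[]" a] c a t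
  by (auto simp: cube_point_def)

lemma act2_path_family:
  assumes A: "inf_presheaf C A" and c: "chain C [f, g]"
  shows "path_family (space_at A (Cod C g)) (space_at A (Dom C f)) (\<lambda>a t. act A [f, g] [t] a)
    (act A [Cmp C g f] []) (\<lambda>a. act A [f] [] (act A [g] [] a))"
  using act2_continuous[OF A c continuous_map_snd continuous_map_fst] act2_ends[OF A c]
  by (auto simp: path_family_def)

lemma square_path_eq:
  "square_path A f h g k a =
     restrict (path_join (\<lambda>t. act A [f, h] [1 - t] a) (\<lambda>t. act A [g, k] [t] a)) {0..1}"
  by (auto simp: square_path_def path_join_def fun_eq_iff)

lemma square_path_family:
  assumes A: "inf_presheaf C A" and sq: "comm_square C f h g k"
  shows "path_family (space_at A (Cod C h)) (space_at A (Dom C f))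
    (\<lambda>a. path_join (\<lambda>t. act A [f, h] [1 - t] a) (\<lambda>t. act A [g, k] [t] a))
    (\<lambda>a. act A [f] [] (act A [h] [] a)) (\<lambda>a. act A [g] [] (act A [k] [] a))"
proof -
  have "chain C [f, h]" "chain C [g, k]" "Dom C f = Dom C g" "Cod C h = Cod C k" "Cmp C h f = Cmp C k g"
    using sq by (auto simp: comm_square_def)
  then show ?thesis
    using path_family_join[OF path_family_reverse[OF act2_path_family[OF A, of f h]]]
      act2_path_family[OF A, of g k] by simp
qed

lemma continuous_square_map:
  assumes A: "inf_presheaf C A" and sq: "comm_square C f h g k"
  shows "continuous_map (space_at A (Cod C h))
    (homotopy_pullback (space_at A (Cod C f)) (space_at A (Cod C g)) (space_at A (Dom C f))
       (act A [f] []) (act A [g] []))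
    (\<lambda>a. (act A [h] [] a, square_path A f h g k a, act A [k] [] a))"
  unfolding square_path_eq
proof (rule continuous_map_homotopy_pullbackI)
  have "h \<in> Arr C" "k \<in> Arr C" "Cod C f = Dom C h" "Cod C g = Dom C k" "Cod C h = Cod C k"
    using sq by (auto simp: comm_square_def)
  then show "continuous_map (space_at A (Cod C h)) (space_at A (Cod C f)) (act A [h] [])"
    "continuous_map (space_at A (Cod C h)) (space_at A (Cod C g)) (act A [k] [])"
    using act1_continuous[OF A, of h] act1_continuous[OF A, of k] by simp_all
qed (rule square_path_family[OF A sq])

abbreviation clamp01 :: "real \<Rightarrow> real" where
  "clamp01 x \<equiv> max 0 (min 1 x)"

text \<open>The comparison map of the left square followed by the pasting equivalence
  \<open>paste\<close> is homotopic to the comparison map of the rectangle followed by the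
  equivalence \<open>shift\<close>. Cancelling the equivalences gives both directions.\<close>

lemma sends_to_pullback_paste:
  assumes A: "inf_presheaf C A" and C: "composable C"
    and sq1: "comm_square C f1 h1 g1 k1" and sq2: "comm_square C f2 g1 g2 k2"
    and right: "sends_to_pullback C A f2 g1 g2 k2"
  shows "sends_to_pullback C A f1 h1 g1 k1 \<longleftrightarrow>
    sends_to_pullback C A (Cmp C f1 f2) h1 g2 (Cmp C k1 k2)"
proof -
  have arr: "f1 \<in> Arr C" "h1 \<in> Arr C" "g1 \<in> Arr C" "k1 \<in> Arr C" "f2 \<in> Arr C" "g2 \<in> Arr C" "k2 \<in> Arr C"
    and dom: "Dom C f1 = Dom C g1" "Cod C f1 = Dom C h1" "Cod C g1 = Dom C k1" "Cod C h1 = Cod C k1"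
      "Dom C f2 = Dom C g2" "Cod C f2 = Dom C g1" "Cod C g2 = Dom C k2" "Cod C k2 = Dom C k1"
    and eqs: "Cmp C h1 f1 = Cmp C k1 g1" "Cmp C g1 f2 = Cmp C k2 g2"
    using sq1 sq2 by (auto simp: comm_square_def)
  have comp: "Cmp C f1 f2 \<in> Arr C" "Dom C (Cmp C f1 f2) = Dom C g2" "Cod C (Cmp C f1 f2) = Dom C h1"
      "Cmp C k1 k2 \<in> Arr C" "Dom C (Cmp C k1 k2) = Dom C k2" "Cod C (Cmp C k1 k2) = Cod C k1"
    using C arr dom by (auto simp: composable_def)
  define Q W P X Y Z where "Q = space_at A (Cod C k1)" and "W = space_at A (Dom C h1)"
    and "P = space_at A (Dom C k1)" and "X = space_at A (Dom C g1)" and "Y = space_at A (Dom C k2)"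
    and "Z = space_at A (Dom C g2)"
  note spaces = Q_def W_def P_def X_def Y_def Z_def
  note cont = act1_continuous[OF A]
  have c1: "continuous_map W X (act A [f1] [])" "continuous_map Q W (act A [h1] [])"
    "continuous_map P X (act A [g1] [])" "continuous_map Q P (act A [k1] [])"
    "continuous_map X Z (act A [f2] [])" "continuous_map Y Z (act A [g2] [])"
    "continuous_map P Y (act A [k2] [])"
    using cont[OF arr(1)] cont[OF arr(2)] cont[OF arr(3)] cont[OF arr(4)] cont[OF arr(5)]
      cont[OF arr(6)] cont[OF arr(7)] by (simp_all add: spaces dom)
  define H where "H = (\<lambda>a. path_join (\<lambda>t. act A [f2, g1] [1 - t] a) (\<lambda>t. act A [g2, k2] [t] a))"
  have H: "path_family P Z H (\<lambda>a. act A [f2] [] (act A [g1] [] a)) (\<lambda>a. act A [g2] [] (act A [k2] [] a))"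
    using square_path_family[OF A sq2] by (simp add: H_def spaces dom)
  have paste: "homotopy_equivalence (homotopy_pullback W P X (act A [f1] []) (act A [g1] []))
      (homotopy_pullback W Y Z (\<lambda>w. act A [f2] [] (act A [f1] [] w)) (act A [g2] []))
      (pullback_paste (act A [f2] []) H (act A [k2] []))"
    using right
    by (intro homotopy_equivalence_paste c1 H)
      (simp add: sends_to_pullback_def square_path_eq H_def spaces dom)
  define sq where "sq = (\<lambda>a. (act A [h1] [] a, square_path A f1 h1 g1 k1 a, act A [k1] [] a))"
  have sqc: "continuous_map Q (homotopy_pullback W P X (act A [f1] []) (act A [g1] [])) sq"
    using continuous_square_map[OF A sq1] by (simp add: sq_def spaces dom)
  \<comment> \<open>The rectangle uses \<open>act A [Cmp C f1 f2] []\<close>, pasting the composite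
    of two maps. Shifting along \<open>F\<close> moves the former pullback to the latter.\<close>
  define F where "F = (\<lambda>w t. act A [f2, f1] [1 - t] w)"
  have F: "path_family W Z F (\<lambda>w. act A [f2] [] (act A [f1] [] w)) (act A [Cmp C f1 f2] [])"
    using path_family_reverse[OF act2_path_family[OF A, of f2 f1]] arr
    by (simp add: F_def spaces dom)
  define out where "out = (\<lambda>a. (act A [h1] [] a, square_path A (Cmp C f1 f2) h1 g2 (Cmp C k1 k2) a,
    act A [Cmp C k1 k2] [] a))"
  let ?E = "homotopy_pullback W Y Z (\<lambda>w. act A [f2] [] (act A [f1] [] w)) (act A [g2] [])"
  define B1 B2 B3 where "B1 = (\<lambda>s t. act A [f2, f1, h1] [s, t])"
    and "B2 = (\<lambda>s t. act A [f2, g1, k1] [s, t])" and "B3 = (\<lambda>s t. act A [g2, k2, k1] [s, t])"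
  have Bc: "continuous_map S Z (\<lambda>y. B1 (s y) (t y) (k y))" "continuous_map S Z (\<lambda>y. B2 (s y) (t y) (k y))"
    "continuous_map S Z (\<lambda>y. B3 (s y) (t y) (k y))"
    if "continuous_map S unit_interval s" "continuous_map S unit_interval t" "continuous_map S Q k"
    for S s t and k :: "'s \<Rightarrow> _"
    using act3_continuous[OF A _ that(1,2), of f2 f1 h1 k] act3_continuous[OF A _ that(1,2), of f2 g1 k1 k]
      act3_continuous[OF A _ that(1,2), of g2 k2 k1 k] that(3)
    by (simp_all add: B1_def B2_def B3_def spaces dom arr)
  have B: "B1 0 t a = act A [Cmp C f1 f2, h1] [t] a" "B1 t 0 a = act A [f2, Cmp C h1 f1] [t] a"
      "B1 1 t a = act A [f2] [] (act A [f1, h1] [t] a)" "B1 t 1 a = act A [f2, f1] [t] (act A [h1] [] a)"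
      "B2 0 t a = act A [Cmp C g1 f2, k1] [t] a" "B2 t 0 a = act A [f2, Cmp C h1 f1] [t] a"
      "B2 1 t a = act A [f2] [] (act A [g1, k1] [t] a)" "B2 t 1 a = act A [f2, g1] [t] (act A [k1] [] a)"
      "B3 0 t a = act A [Cmp C g1 f2, k1] [t] a" "B3 t 0 a = act A [g2, Cmp C k1 k2] [t] a"
      "B3 1 t a = act A [g2] [] (act A [k2, k1] [t] a)" "B3 t 1 a = act A [g2, k2] [t] (act A [k1] [] a)"
    if "a \<in> topspace Q" "0 \<le> t" "t \<le> 1" for t a
    using act3_faces[OF A, of f2 f1 h1 a t] act3_faces[OF A, of f2 g1 k1 a t]
      act3_faces[OF A, of g2 k2 k1 a t] that
    by (simp_all add: B1_def B2_def B3_def spaces dom arr eqs)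
  have f2f1: "act A [f2, f1] [1] (act A [h1] [] a) = act A [f2] [] (act A [f1] [] (act A [h1] [] a))"
    if "a \<in> topspace Q" for a
    using path_family_ends(1)[OF F continuous_map_point[OF c1(2) that]] by (simp add: F_def)
  text \<open>\<open>B1\<close> and \<open>B2\<close> agree along the edge where their second argument is \<open>0\<close>; gluing them there gives a
    map on \<open>[0, 1] \<times> [-1, 1]\<close>.  The outer square and the pasted one trace two curves in this rectangle
    before they continue in \<open>B3\<close>, and \<open>(x s, y s)\<close> is the straight-line homotopy between the curves.\<close>
  define x where "x = (\<lambda>s t :: real. (1 - s) * max 0 (1 - 2 * t) + s * min 1 (3 - 4 * t))"
  define y where "y = (\<lambda>s t :: real. (1 - s) * max (-1) (4 * t - 3) + s * min 1 (4 * t - 1))"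
  define c where "c = (\<lambda>s a t. if t \<le> 3/4
     then (if y s t \<le> 0 then B1 (clamp01 (x s t)) (clamp01 (- y s t)) a
           else B2 (clamp01 (x s t)) (clamp01 (y s t)) a)
     else B3 (clamp01 (4 * t - 3)) s a)"
  \<comment> \<open>Both curves start at \<open>(1, -1)\<close>. For \<open>s = 0\<close> the curve
    runs along \<open>y = -1\<close>, which is \<open>F\<close>, and then along \<open>x = 0\<close>
    up to \<open>(0, 0)\<close>; for \<open>s = 1\<close> it runs along \<open>x = 1\<close> and
    then along \<open>y = 1\<close> to \<open>(0, 1)\<close>. At \<open>t = 3/4\<close> stage
    \<open>s\<close> has reached \<open>(0, s)\<close>, where \<open>B2\<close> meets
    \<open>B3\<close> because \<open>Cmp C g1 f2 = Cmp C k2 g2\<close>. The end of the path in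
    \<open>B3\<close> depends on \<open>s\<close>, so the point of \<open>Y\<close> moves along
    \<open>act A [k2, k1] [s]\<close>.\<close>
  have "homotopic Q ?E (pullback_shift (\<lambda>w. w) F \<circ> out)
      (pullback_paste (act A [f2] []) H (act A [k2] []) \<circ> sq)"
  proof (rule homotopic_homotopy_pullbackI[where a = "\<lambda>s a. act A [h1] [] a"
        and b = "\<lambda>s a. act A [k2, k1] [s] a" and c = c])
    let ?IQ = "prod_topology unit_interval Q"
    show "continuous_map ?IQ W (\<lambda>p. act A [h1] [] (snd p))"
      by (rule continuous_map_comp[OF c1(2) continuous_map_snd])
    show "continuous_map ?IQ Y (\<lambda>p. act A [k2, k1] [fst p] (snd p))"
      using act2_continuous[OF A _ continuous_map_fst, of k2 k1 Q snd] continuous_map_snd[of unit_interval Q]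
      by (simp add: spaces dom arr)
    show "path_family ?IQ Z (\<lambda>p. c (fst p) (snd p)) (\<lambda>p. act A [f2] [] (act A [f1] [] (act A [h1] [] (snd p))))
      (\<lambda>p. act A [g2] [] (act A [k2, k1] [fst p] (snd p)))"
      unfolding path_family_def
    proof (intro conjI ballI)
      let ?S = "prod_topology ?IQ unit_interval"
      have a: "continuous_map ?S Q (\<lambda>p. snd (fst p))"
        by (rule continuous_map_proj)
      have s: "continuous_map ?S unit_interval (\<lambda>p. fst (fst p))"
        by (rule continuous_map_proj)
      have t: "continuous_map ?S euclideanreal snd"
        by (rule unit_interval_real) (rule continuous_map_snd)
      note s' = unit_interval_real[OF s]
      have xy: "continuous_map ?S euclideanreal (\<lambda>p. x (fst (fst p)) (snd p))"
        "continuous_map ?S euclideanreal (\<lambda>p. y (fst (fst p)) (snd p))"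
        unfolding x_def y_def
        by (intro continuous_map_add continuous_map_real_mult continuous_map_diff continuous_map_real_max
            continuous_map_real_min continuous_map_canonical_const s' t)+
      show "continuous_map ?S Z (\<lambda>p. c (fst (fst p)) (snd (fst p)) (snd p))"
        unfolding c_def
      proof (rule continuous_map_if_le[OF t])
        show "continuous_map ?S Z (\<lambda>p. if y (fst (fst p)) (snd p) \<le> 0
            then B1 (clamp01 (x (fst (fst p)) (snd p))) (clamp01 (- y (fst (fst p)) (snd p))) (snd (fst p))
            else B2 (clamp01 (x (fst (fst p)) (snd p))) (clamp01 (y (fst (fst p)) (snd p))) (snd (fst p)))"
          by (intro continuous_map_if_le Bc a continuous_map_clamp continuous_map_minus xy) (auto simp: B)
        show "continuous_map ?S Z (\<lambda>p. B3 (clamp01 (4 * snd p - 3)) (fst (fst p)) (snd (fst p)))"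
          by (intro Bc a s continuous_map_clamp continuous_map_diff continuous_map_real_mult
              continuous_map_canonical_const t)
        \<comment> \<open>For \<open>s = 0\<close> the first branch applies and yields the corner of
          \<open>B1\<close>, so the corner must be passed on from \<open>B1\<close> to
          \<open>B2\<close> along their common edge before it reaches \<open>B3\<close>.\<close>
        fix p assume p: "p \<in> topspace ?S" "snd p = 3/4"
        have xy0: "x (fst (fst p)) (3/4) = 0" "y (fst (fst p)) (3/4) = fst (fst p)"
          by (simp_all add: x_def y_def)
        have "0 \<le> fst (fst p)" "fst (fst p) \<le> 1" "snd (fst p) \<in> topspace Q"
          using p(1) by auto
        then show "(if y (fst (fst p)) (snd p) \<le> 0
            then B1 (clamp01 (x (fst (fst p)) (snd p))) (clamp01 (- y (fst (fst p)) (snd p))) (snd (fst p))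
            else B2 (clamp01 (x (fst (fst p)) (snd p))) (clamp01 (y (fst (fst p)) (snd p))) (snd (fst p))) =
          B3 (clamp01 (4 * snd p - 3)) (fst (fst p)) (snd (fst p))"
          unfolding p(2) xy0 using B(5,6)[of "snd (fst p)" 0] by (auto simp: B eqs)
      qed
      fix p assume "p \<in> topspace ?IQ"
      then show "c (fst p) (snd p) 0 = act A [f2] [] (act A [f1] [] (act A [h1] [] (snd p)))"
        "c (fst p) (snd p) 1 = act A [g2] [] (act A [k2, k1] [fst p] (snd p))"
        by (auto simp: c_def x_def y_def B f2f1)
    qed
    fix a assume a: "a \<in> topspace Q"
    have "c 0 a t = path_join (F (act A [h1] [] a)) (square_path A (Cmp C f1 f2) h1 g2 (Cmp C k1 k2) a) t"
      if t: "t \<in> {0..1}" for t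
    proof -
      consider "t \<le> 1/2" | "1/2 < t" "t \<le> 3/4" | "3/4 < t"
        by linarith
      then show ?thesis
        by cases (use a t in \<open>auto simp: c_def x_def y_def B F_def path_join_def square_path_def\<close>)
    qed
    then show "(pullback_shift (\<lambda>w. w) F \<circ> out) a =
        (act A [h1] [] a, restrict (c 0 a) {0..1}, act A [k2, k1] [0] a)"
      using act2_ends(1)[OF A, of k2 k1 a] a
      by (auto simp: pullback_shift_def out_def fun_eq_iff spaces dom arr)
    have "c 1 a t = path_join (\<lambda>t. act A [f2] [] (square_path A f1 h1 g1 k1 a t)) (H (act A [k1] [] a)) t"
      if t: "t \<in> {0..1}" for t
    proof -
      consider "t \<le> 1/4" | "1/4 < t" "t \<le> 1/2" | "1/2 < t" "t \<le> 3/4" | "3/4 < t"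
        by linarith
      then show ?thesis
        by cases (use a t in \<open>auto simp: c_def x_def y_def B H_def path_join_def square_path_def\<close>)
    qed
    then show "(pullback_paste (act A [f2] []) H (act A [k2] []) \<circ> sq) a =
        (act A [h1] [] a, restrict (c 1 a) {0..1}, act A [k2, k1] [1] a)"
      using act2_ends(2)[OF A, of k2 k1 a] a
      by (auto simp: pullback_paste_def sq_def fun_eq_iff spaces dom arr)
  qed
  note hom = this
  have "continuous_map Q (homotopy_pullback W Y Z (act A [Cmp C f1 f2] []) (act A [g2] [])) out"
    using continuous_square_map[OF A comm_square_paste[OF C sq1 sq2]]
    by (simp add: out_def spaces dom comp)
  note outc = this
  have shift: "homotopy_equivalence (homotopy_pullback W Y Z (act A [Cmp C f1 f2] []) (act A [g2] [])) ?E
      (pullback_shift (\<lambda>w. w) F)"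
    by (rule homotopy_equivalence_shift_id[OF F])
  have "sends_to_pullback C A f1 h1 g1 k1 \<longleftrightarrow>
      homotopy_equivalence Q (homotopy_pullback W P X (act A [f1] []) (act A [g1] [])) sq"
    by (simp add: sends_to_pullback_def sq_def spaces dom)
  also have "\<dots> \<longleftrightarrow> homotopy_equivalence Q ?E (pullback_paste (act A [f2] []) H (act A [k2] []) \<circ> sq)"
    using homotopy_equivalence_compose[OF _ paste] homotopy_equivalence_cancel_left[OF paste _ sqc] by blast
  also have "\<dots> \<longleftrightarrow> homotopy_equivalence Q ?E (pullback_shift (\<lambda>w. w) F \<circ> out)"
    using homotopy_equivalence_homotopic[OF _ hom] homotopy_equivalence_homotopic[OF _ homotopic_sym[OF hom]]
    by blast
  also have "\<dots> \<longleftrightarrow> homotopy_equivalence Q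
      (homotopy_pullback W Y Z (act A [Cmp C f1 f2] []) (act A [g2] [])) out"
    using homotopy_equivalence_compose[OF _ shift] homotopy_equivalence_cancel_left[OF shift _ outc] by blast
  also have "\<dots> \<longleftrightarrow> sends_to_pullback C A (Cmp C f1 f2) h1 g2 (Cmp C k1 k2)"
    by (simp add: sends_to_pullback_def out_def spaces dom comp)
  finally show ?thesis .
qed

section \<open>The Segal squares of a flanked decomposition space\<close>

lemma Delta_simps [simp]:
  "Obj Delta = {0..}"
  "(m, n, f) \<in> Arr Delta \<longleftrightarrow> 0 \<le> m \<and> 0 \<le> n \<and> f \<in> {0..m} \<rightarrow>\<^sub>E {0..n} \<and> mono_on {0..m} f"
  "Dom Delta (m, n, f) = m" "Cod Delta (m, n, f) = n"
  "Cmp Delta (m', n', g) (m, n, f) = (m, n', compose {0..m} g f)"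
  "Ident Delta n = (n, n, \<lambda>i\<in>{0..n}. i)"
  by (simp_all add: Delta_def)

lemma Xi_simps [simp]:
  "(m, n, f) \<in> Arr Xi \<longleftrightarrow> -1 \<le> m \<and> -1 \<le> n \<and> f \<in> {-1..m + 1} \<rightarrow>\<^sub>E {-1..n + 1} \<and>
     mono_on {-1..m + 1} f \<and> f (-1) = -1 \<and> f (m + 1) = n + 1"
  "Dom Xi (m, n, f) = m" "Cod Xi (m, n, f) = n"
  "Cmp Xi (m', n', g) (m, n, f) = (m, n', compose {-1..m + 1} g f)"
  by (simp_all add: Xi_def)

lemma composable_Delta: "composable Delta"
  unfolding composable_def
proof (intro conjI allI impI)
  fix f g :: order_map
  obtain m n a where f: "f = (m, n, a)" by (cases f)
  obtain k l b where g: "g = (k, l, b)" by (cases g)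
  assume fg: "f \<in> Arr Delta" "g \<in> Arr Delta" "Cod Delta f = Dom Delta g"
  then show "Cmp Delta g f \<in> Arr Delta"
    by (auto simp: f g mono_on_def compose_def PiE_iff)
  show "Dom Delta (Cmp Delta g f) = Dom Delta f" "Cod Delta (Cmp Delta g f) = Cod Delta g"
    by (auto simp: f g)
  fix h :: order_map
  obtain p q c where h: "h = (p, q, c)" by (cases h)
  assume "h \<in> Arr Delta" "Cod Delta g = Dom Delta h"
  then show "Cmp Delta h (Cmp Delta g f) = Cmp Delta (Cmp Delta h g) f"
    using fg by (auto simp: f g h compose_def fun_eq_iff PiE_iff)
qed

lemma composable_Xi: "composable Xi"
  unfolding composable_def
proof (intro conjI allI impI)
  fix f g :: order_map
  obtain m n a where f: "f = (m, n, a)" by (cases f)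
  obtain k l b where g: "g = (k, l, b)" by (cases g)
  assume fg: "f \<in> Arr Xi" "g \<in> Arr Xi" "Cod Xi f = Dom Xi g"
  then show "Cmp Xi g f \<in> Arr Xi"
    by (auto simp: f g mono_on_def compose_def PiE_iff)
  show "Dom Xi (Cmp Xi g f) = Dom Xi f" "Cod Xi (Cmp Xi g f) = Cod Xi g"
    by (auto simp: f g)
  fix h :: order_map
  obtain p q c where h: "h = (p, q, c)" by (cases h)
  assume "h \<in> Arr Xi" "Cod Xi g = Dom Xi h"
  then show "Cmp Xi h (Cmp Xi g f) = Cmp Xi (Cmp Xi h g) f"
    using fg by (auto simp: f g h compose_def fun_eq_iff PiE_iff)
qed

lemma adjoin_ends_simps [simp]:
  "Dom Xi (adjoin_ends f) = Dom Delta f" "Cod Xi (adjoin_ends f) = Cod Delta f"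
  by (cases f; simp add: adjoin_ends_def)+

lemma underlying_simps [simp]:
  "space_at (underlying A) = space_at A" "act (underlying A) fs = act A (map adjoin_ends fs)"
  by (simp_all add: underlying_def)

lemma sends_to_pullback_underlying:
  "sends_to_pullback Delta (underlying A) f h g k \<longleftrightarrow>
     sends_to_pullback Xi A (adjoin_ends f) (adjoin_ends h) (adjoin_ends g) (adjoin_ends k)"
  by (simp add: sends_to_pullback_def square_path_def cong: if_cong)

definition delta_top :: "int \<Rightarrow> order_map" where
  "delta_top n = (n - 1, n, \<lambda>i\<in>{0..n - 1}. i)"

definition delta_bot :: "int \<Rightarrow> order_map" where
  "delta_bot n = (n - 1, n, \<lambda>i\<in>{0..n - 1}. i + 1)"

text \<open>The coface skipping \<open>1\<close>. It is generic as soon as \<open>n \<ge> 2\<close>;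
  for \<open>n = 1\<close> it is the top coface and misses the upper end-point.\<close>

definition delta_one :: "int \<Rightarrow> order_map" where
  "delta_one n = (n - 1, n, \<lambda>i\<in>{0..n - 1}. if i = 0 then 0 else i + 1)"

lemma adjoin_delta:
  "n \<ge> 1 \<Longrightarrow> adjoin_ends (delta_top n) = coface_top n"
  "n \<ge> 1 \<Longrightarrow> adjoin_ends (delta_bot n) = coface_bot n"
  by (auto simp: adjoin_ends_def delta_top_def delta_bot_def coface_top_def coface_bot_def fun_eq_iff)

text \<open>Along \<open>delta_top n\<close> a new last element is added, and this commutes with
  inserting an element after the first one.\<close>

lemma pushout_delta_one_delta_top:
  assumes n: "n \<ge> 2"
  shows "pushout_square Delta (delta_one n) (delta_top (n + 1)) (delta_top n) (delta_one (n + 1))"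
  unfolding pushout_square_def
proof (intro conjI allI impI)
  show "comm_square Delta (delta_one n) (delta_top (n + 1)) (delta_top n) (delta_one (n + 1))"
    using n by (auto simp: comm_square_def delta_one_def delta_top_def mono_on_def compose_def fun_eq_iff)
  fix u v assume sq: "comm_square Delta (delta_one n) u (delta_top n) v"
  obtain m a where u: "u = (n, m, a)"
    using sq by (cases u) (auto simp: comm_square_def delta_one_def)
  obtain b where v: "v = (n, m, b)"
    using sq by (cases v) (auto simp: comm_square_def delta_one_def delta_top_def u)
  have a: "a \<in> {0..n} \<rightarrow>\<^sub>E {0..m}" "mono_on {0..n} a" and b: "b \<in> {0..n} \<rightarrow>\<^sub>E {0..m}" "mono_on {0..n} b"
    and m: "0 \<le> m"
    using sq by (auto simp: comm_square_def u v)
  have ab: "a (if i = 0 then 0 else i + 1) = b i" if "0 \<le> i" "i \<le> n - 1" for i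
    using sq that
    by (auto simp: comm_square_def u v delta_one_def delta_top_def compose_def dest!: fun_cong[of _ _ i])
  \<comment> \<open>The image of \<open>delta_top (n + 1)\<close> misses only \<open>n + 1\<close>,
    which \<open>delta_one (n + 1)\<close> hits at \<open>n\<close>; so this choice is
    forced.\<close>
  define w where "w = (\<lambda>i\<in>{0..n + 1}. if i \<le> n then a i else b n)"
  \<comment> \<open>This needs \<open>n \<ge> 2\<close>, as \<open>delta_one n\<close> sends
    \<open>n - 1\<close> to \<open>n\<close> only if \<open>n - 1\<close> is not \<open>0\<close>.
    It makes \<open>w\<close> monotone at its last step:
    \<open>a n = b (n - 1) \<le> b n\<close>.\<close>
  have an: "a n = b (n - 1)"
    using ab[of "n - 1"] n by simp
  show "\<exists>!w. w \<in> Arr Delta \<and> Dom Delta w = Cod Delta (delta_top (n + 1)) \<and> Cod Delta w = Cod Delta u \<and>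
      Cmp Delta w (delta_top (n + 1)) = u \<and> Cmp Delta w (delta_one (n + 1)) = v"
  proof (rule ex1I, intro conjI)
    have "a i \<le> b n" if "0 \<le> i" "i \<le> n" for i
    proof -
      have "a i \<le> a n"
        using that n by (intro mono_onD[OF a(2)]) auto
      also have "a n \<le> b n"
        unfolding an using n by (intro mono_onD[OF b(2)]) auto
      finally show ?thesis .
    qed
    then have "mono_on {0..n + 1} w"
      using a(2) by (auto simp: w_def mono_on_def)
    moreover have "w \<in> {0..n + 1} \<rightarrow>\<^sub>E {0..m}"
      using a(1) b(1) n by (auto simp: w_def PiE_iff)
    ultimately show "(n + 1, m, w) \<in> Arr Delta"
      using n m by simp
    show "Cmp Delta (n + 1, m, w) (delta_top (n + 1)) = u"
      using a(1) by (auto simp: u delta_top_def w_def compose_def fun_eq_iff PiE_iff extensional_def)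
    have "compose {0..n} w (\<lambda>i\<in>{0..n}. if i = 0 then 0 else i + 1) = b"
    proof
      fix i
      consider "i < 0 \<or> n < i" | "0 \<le> i" "i \<le> n - 1" | "i = n"
        by linarith
      then show "compose {0..n} w (\<lambda>i\<in>{0..n}. if i = 0 then 0 else i + 1) i = b i"
        using b(1) ab[of i] n by cases (auto simp: w_def compose_def PiE_iff extensional_def)
    qed
    then show "Cmp Delta (n + 1, m, w) (delta_one (n + 1)) = v"
      by (simp add: v delta_one_def)
  next
    fix w'
    assume w': "w' \<in> Arr Delta \<and> Dom Delta w' = Cod Delta (delta_top (n + 1)) \<and> Cod Delta w' = Cod Delta u \<and>
      Cmp Delta w' (delta_top (n + 1)) = u \<and> Cmp Delta w' (delta_one (n + 1)) = v"
    then obtain c where c: "w' = (n + 1, m, c)"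
      by (cases w') (auto simp: u delta_top_def)
    have "c i = w i" for i
    proof -
      consider "i < 0 \<or> n + 1 < i" | "0 \<le> i" "i \<le> n" | "i = n + 1"
        by linarith
      then show ?thesis
      proof cases
        case 1
        then show ?thesis
          using w' by (auto simp: c w_def PiE_iff extensional_def)
      next
        case 2
        then show ?thesis
          using w' by (auto simp: c u delta_top_def w_def compose_def dest!: fun_cong[of _ _ i])
      next
        case 3
        then show ?thesis
          using w' n by (auto simp: c v delta_one_def w_def compose_def dest!: fun_cong[of _ _ n])
      qed
    qed
    then show "w' = (n + 1, m, w)"
      by (simp add: c fun_eq_iff)
  qed (use n in \<open>auto simp: u delta_top_def\<close>)
qed

text \<open>Two outer cofaces span this square, so it is no instance of the decomposition axiom. It
  is reached by one pasting in the forward direction and one cancellation.\<close>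

lemma flanked_segal_square:
  assumes A: "flanked_decomposition_space A" and n: "n \<ge> 2"
  shows "sends_to_pullback Delta (underlying A)
    (delta_bot (n - 1)) (delta_top n) (delta_top (n - 1)) (delta_bot n)"
proof -
  have inf: "inf_presheaf Xi A" and flank: "\<And>n. n \<ge> 0 \<Longrightarrow> sends_to_pullback Xi A
      (extra_codeg_bot n) (coface_top n) (coface_top (n + 1)) (extra_codeg_bot (n + 1))"
    using A by (auto simp: flanked_decomposition_space_def flanked_def)
  let ?d = "\<lambda>n. adjoin_ends (delta_one n)"
  have "generic_map (delta_one n)" "free_map (delta_top n)"
    using n by (auto simp: generic_map_def free_map_def delta_one_def delta_top_def)
  then have "sends_to_pullback Delta (underlying A)
      (delta_one n) (delta_top (n + 1)) (delta_top n) (delta_one (n + 1))"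
    using A pushout_delta_one_delta_top[OF n]
    unfolding flanked_decomposition_space_def decomposition_space_def by blast
  then have decomp: "sends_to_pullback Xi A (?d n) (coface_top (n + 1)) (coface_top n) (?d (n + 1))"
    using n by (simp add: sends_to_pullback_underlying adjoin_delta)
  have "comm_square Xi (extra_codeg_bot n) (coface_top n) (coface_top (n + 1)) (extra_codeg_bot (n + 1))"
      "comm_square Xi (?d n) (coface_top (n + 1)) (coface_top n) (?d (n + 1))"
    using n by (auto simp: comm_square_def extra_codeg_bot_def coface_top_def adjoin_ends_def delta_one_def
        mono_on_def compose_def fun_eq_iff)
  from sends_to_pullback_paste[OF inf composable_Xi this decomp] flank[of n] n
  have "sends_to_pullback Xi A (Cmp Xi (extra_codeg_bot n) (?d n)) (coface_top n) (coface_top n)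
      (Cmp Xi (extra_codeg_bot (n + 1)) (?d (n + 1)))"
    by simp
  \<comment> \<open>In each equation both sides send the inner element \<open>0\<close> to bottom
    and leave every other inner element in place.\<close>
  moreover have "Cmp Xi (extra_codeg_bot n) (?d n) = Cmp Xi (coface_bot (n - 1)) (extra_codeg_bot (n - 1))"
    "Cmp Xi (extra_codeg_bot (n + 1)) (?d (n + 1)) = Cmp Xi (coface_bot n) (extra_codeg_bot n)"
    using n by (auto simp: extra_codeg_bot_def coface_bot_def adjoin_ends_def delta_one_def
        compose_def fun_eq_iff)
  ultimately have outer: "sends_to_pullback Xi A (Cmp Xi (coface_bot (n - 1)) (extra_codeg_bot (n - 1)))
      (coface_top n) (coface_top n) (Cmp Xi (coface_bot n) (extra_codeg_bot n))"
    by simp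
  have "comm_square Xi (coface_bot (n - 1)) (coface_top n) (coface_top (n - 1)) (coface_bot n)"
    "comm_square Xi (extra_codeg_bot (n - 1)) (coface_top (n - 1)) (coface_top n) (extra_codeg_bot n)"
    using n by (auto simp: comm_square_def extra_codeg_bot_def coface_top_def coface_bot_def
        mono_on_def compose_def fun_eq_iff)
  from sends_to_pullback_paste[OF inf composable_Xi this] flank[of "n - 1"] n outer
  show ?thesis
    by (simp add: sends_to_pullback_underlying adjoin_delta)
qed

section \<open>Splitting off the last edge\<close>

definition last_vertex :: "int \<Rightarrow> order_map" where
  "last_vertex n = (0, n, \<lambda>i\<in>{0..0}. n)"

definition last_edge :: "int \<Rightarrow> order_map" where
  "last_edge n = (1, n, \<lambda>i\<in>{0..1}. n - 1 + i)"

lemma last_edge_square: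
  assumes "n \<ge> 2"
  shows "comm_square Delta (last_vertex (n - 1)) (delta_top n) source_vertex (last_edge n)"
  using assms by (auto simp: comm_square_def last_vertex_def delta_top_def source_vertex_def last_edge_def
      mono_on_def compose_def fun_eq_iff)

text \<open>For \<open>n = 2\<close> this is a square of outer cofaces. Each further step pastes on
  one more such square, and \<open>delta_bot\<close> takes the last vertex and the last edge to the
  last vertex and the last edge again.\<close>

lemma flanked_last_edge_square:
  assumes A: "flanked_decomposition_space A" and n: "n \<ge> 2"
  shows "sends_to_pullback Delta (underlying A) (last_vertex (n - 1)) (delta_top n) source_vertex (last_edge n)"
  using n
proof (induction n rule: int_ge_induct)
  case base
  have "last_vertex (2 - 1) = delta_bot (2 - 1)" "source_vertex = delta_top (2 - 1)" "last_edge 2 = delta_bot 2"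
    by (auto simp: last_vertex_def delta_bot_def source_vertex_def delta_top_def last_edge_def fun_eq_iff)
  then show ?case
    using flanked_segal_square[OF A, of 2] by simp
next
  case (step n)
  have inf: "inf_presheaf Delta (underlying A)"
    using A by (simp add: flanked_decomposition_space_def decomposition_space_def)
  have "comm_square Delta (delta_bot n) (delta_top (n + 1)) (delta_top n) (delta_bot (n + 1))"
    using step.hyps by (auto simp: comm_square_def delta_bot_def delta_top_def mono_on_def compose_def fun_eq_iff)
  from sends_to_pullback_paste[OF inf composable_Delta this last_edge_square[OF step.hyps] step.IH]
    flanked_segal_square[OF A, of "n + 1"] step.hyps
  have "sends_to_pullback Delta (underlying A) (Cmp Delta (delta_bot n) (last_vertex (n - 1)))
      (delta_top (n + 1)) source_vertex (Cmp Delta (delta_bot (n + 1)) (last_edge n))"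
    by simp
  moreover have "Cmp Delta (delta_bot n) (last_vertex (n - 1)) = last_vertex n"
    "Cmp Delta (delta_bot (n + 1)) (last_edge n) = last_edge (n + 1)"
    using step.hyps by (auto simp: delta_bot_def last_vertex_def last_edge_def compose_def fun_eq_iff)
  ultimately show ?case
    by simp
qed

section \<open>The Segal map\<close>

lemma segal_limit_point:
  assumes "e \<in> topspace (segal_limit X r)"
  shows "fst e \<in> {..<r} \<rightarrow>\<^sub>E topspace (space_at X 1)" "snd e \<in> {..<r - 1} \<rightarrow>\<^sub>E path_set (space_at X 0)"
    and "j < r - 1 \<Longrightarrow> snd e j 0 = act X [target_vertex] [] (fst e j)"
    and "j < r - 1 \<Longrightarrow> snd e j 1 = act X [source_vertex] [] (fst e (Suc j))"
  using assms by (auto simp: segal_limit_def)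

lemma continuous_map_segal_limit_vertex:
  "j < r \<Longrightarrow> continuous_map (segal_limit X r) (space_at X 1) (\<lambda>e. fst e j)"
  unfolding segal_limit_def by (intro continuous_map_from_subtopology continuous_map_prod_fst) simp

lemma path_family_segal_limit:
  assumes "j < r - 1"
  shows "path_family (segal_limit X r) (space_at X 0) (\<lambda>e. snd e j)
    (\<lambda>e. act X [target_vertex] [] (fst e j)) (\<lambda>e. act X [source_vertex] [] (fst e (Suc j)))"
proof -
  have "continuous_map (segal_limit X r) (path_space (space_at X 0)) (\<lambda>e. snd e j)"
    unfolding segal_limit_def using assms
    by (intro continuous_map_from_subtopology continuous_map_prod_snd) simp
  from continuous_map_uncurry[OF continuous_map_comp[OF this continuous_map_fst] continuous_map_snd]
  show ?thesis
    using assms by (auto simp: path_family_def dest: segal_limit_point(3,4))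
qed

lemma continuous_map_segal_limitI:
  assumes x: "\<And>j. j < r \<Longrightarrow> continuous_map S (space_at X 1) (\<lambda>y. x y j)"
    and c: "\<And>j. j < r - 1 \<Longrightarrow> path_family S (space_at X 0) (\<lambda>y. c y j)
      (\<lambda>y. act X [target_vertex] [] (x y j)) (\<lambda>y. act X [source_vertex] [] (x y (Suc j)))"
  shows "continuous_map S (segal_limit X r)
    (\<lambda>y. (\<lambda>j\<in>{..<r}. x y j, \<lambda>j\<in>{..<r - 1}. restrict (c y j) {0..1}))"
  unfolding segal_limit_def
proof (intro continuous_map_into_subtopology continuous_map_pairedI)
  show "continuous_map S (product_topology (\<lambda>_. space_at X 1) {..<r}) (\<lambda>y. \<lambda>j\<in>{..<r}. x y j)"
    using x by (intro continuous_map_coordinatewise_then_product) auto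
  have "continuous_map S (path_space (space_at X 0)) (\<lambda>y. restrict (c y j) {0..1})" if "j < r - 1" for j
    using c[OF that] by (intro continuous_map_curry) (simp add: path_family_def)
  then show "continuous_map S (product_topology (\<lambda>_. path_space (space_at X 0)) {..<r - 1})
      (\<lambda>y. \<lambda>j\<in>{..<r - 1}. restrict (c y j) {0..1})"
    by (intro continuous_map_coordinatewise_then_product) auto
qed (use path_family_ends[OF c] in auto)

lemma segal_map_one:
  assumes X: "inf_presheaf Delta X"
  shows "homotopy_equivalence (space_at X 1) (segal_limit X 1) (segal_map X 1)"
proof -
  have "spine_edge 1 0 = Ident Delta 1"
    by (auto simp: spine_edge_def)
  then have e: "act X [spine_edge 1 0] [] a = a" if "a \<in> topspace (space_at X 1)" for a
    using inf_presheaf_ident[OF X, of 1 a] that by simp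
  \<comment> \<open>With one edge there are no connecting paths. The \<open>undefined\<close> is a
    filler over an empty index set that gives the map the shape expected by
    \<open>continuous_map_segal_limitI\<close>.\<close>
  have "homotopy_equivalence (space_at X 1) (segal_limit X 1)
      (\<lambda>a. (\<lambda>j\<in>{..<1}. a, \<lambda>j\<in>{..<1 - 1}. restrict undefined {0..1}))"
  proof (rule homotopy_equivalence_inverse[where g = "\<lambda>e. fst e 0"])
    show "continuous_map (space_at X 1) (segal_limit X 1)
        (\<lambda>a. (\<lambda>j\<in>{..<1}. a, \<lambda>j\<in>{..<1 - 1}. restrict undefined {0..1}))"
      using continuous_map_id[of "space_at X 1"]
      by (intro continuous_map_segal_limitI[where x = "\<lambda>a j. a" and c = "\<lambda>a j. undefined"]) (auto simp: id_def)
    show "continuous_map (segal_limit X 1) (space_at X 1) (\<lambda>e. fst e 0)"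
      by (rule continuous_map_segal_limit_vertex) simp
    fix e assume "e \<in> topspace (segal_limit X 1)"
    from segal_limit_point(1,2)[OF this]
    show "(\<lambda>j\<in>{..<1}. fst e 0, \<lambda>j\<in>{..<1 - 1}. restrict undefined {0..1}) = e"
      by (cases e) (auto simp: fun_eq_iff PiE_iff extensional_def)
  qed simp
  then show ?thesis
    by (rule homotopy_equivalence_cong) (auto simp: segal_map_def e[simplified] fun_eq_iff)
qed

text \<open>A mere regrouping with a strict inverse: the last edge and the path leading to it, of
  index \<open>r - 1\<close>, are separated from the rest. The restrictions do nothing to actual
  points, whose paths are extensional.\<close>

lemma homotopy_equivalence_segal_limit_Suc:
  fixes r :: nat
  assumes "r \<ge> 1"
  shows "homotopy_equivalence
    (homotopy_pullback (segal_limit X r) (space_at X 1) (space_at X 0)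
       (\<lambda>e. act X [target_vertex] [] (fst e (r - 1))) (act X [source_vertex] []))
    (segal_limit X (Suc r))
    (\<lambda>e. (\<lambda>j\<in>{..<Suc r}. if j < r then fst (fst e) j else snd (snd e),
          \<lambda>j\<in>{..<Suc r - 1}. restrict (if j < r - 1 then snd (fst e) j else fst (snd e)) {0..1}))"
    (is "homotopy_equivalence ?E ?L ?\<theta>")
proof (rule homotopy_equivalence_inverse)
  let ?\<eta> = "\<lambda>e. ((\<lambda>j\<in>{..<r}. fst e j, \<lambda>j\<in>{..<r - 1}. restrict (snd e j) {0..1}),
    restrict (snd e (r - 1)) {0..1}, fst e r)"
  note proj = continuous_map_comp[OF continuous_map_segal_limit_vertex homotopy_pullback_fst]
  note path = path_family_comp[OF path_family_segal_limit homotopy_pullback_fst]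
  show "continuous_map ?E ?L ?\<theta>"
  proof (rule continuous_map_segal_limitI)
    show "continuous_map ?E (space_at X 1) (\<lambda>e. if j < r then fst (fst e) j else snd (snd e))"
      if "j < Suc r" for j
      using proj[of j] homotopy_pullback_snd by (cases "j < r") auto
    show "path_family ?E (space_at X 0) (\<lambda>e. if j < r - 1 then snd (fst e) j else fst (snd e))
        (\<lambda>e. act X [target_vertex] [] (if j < r then fst (fst e) j else snd (snd e)))
        (\<lambda>e. act X [source_vertex] [] (if Suc j < r then fst (fst e) (Suc j) else snd (snd e)))"
      if "j < Suc r - 1" for j
    proof (cases "j < r - 1")
      case True
      then have "j < r" "Suc j < r"
        by auto
      then show ?thesis
        using path[OF True] True by simp
    next
      case False
      then have "j = r - 1" "\<not> Suc j < r" "j < r"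
        using that by auto
      then show ?thesis
        using homotopy_pullback_path[of "segal_limit X r" "space_at X 1" "space_at X 0"
            "\<lambda>e. act X [target_vertex] [] (fst e (r - 1))" "act X [source_vertex] []"] by simp
    qed
  qed
  show "continuous_map ?L ?E ?\<eta>"
  proof (rule continuous_map_homotopy_pullbackI)
    show "continuous_map ?L (segal_limit X r)
        (\<lambda>e. (\<lambda>j\<in>{..<r}. fst e j, \<lambda>j\<in>{..<r - 1}. restrict (snd e j) {0..1}))"
      by (intro continuous_map_segal_limitI continuous_map_segal_limit_vertex path_family_segal_limit) auto
    show "continuous_map ?L (space_at X 1) (\<lambda>e. fst e r)"
      by (rule continuous_map_segal_limit_vertex) simp
    show "path_family ?L (space_at X 0) (\<lambda>e. snd e (r - 1))
        (\<lambda>e. act X [target_vertex] [] (fst (\<lambda>j\<in>{..<r}. fst e j, \<lambda>j\<in>{..<r - 1}. restrict (snd e j) {0..1}) (r - 1)))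
        (\<lambda>e. act X [source_vertex] [] (fst e r))"
      using path_family_segal_limit[of "r - 1" "Suc r" X] assms by simp
  qed
  fix e assume e: "e \<in> topspace ?E"
  then have "fst e \<in> topspace (segal_limit X r)" and \<eta>: "fst (snd e) \<in> extensional {0..1}"
    by (auto simp: topspace_homotopy_pullback path_set_iff)
  then have "fst (fst e) \<in> extensional {..<r}" "snd (fst e) \<in> extensional {..<r - 1}"
    "\<And>j. j < r - 1 \<Longrightarrow> snd (fst e) j \<in> extensional {0..1}"
    using segal_limit_point(1,2)[of "fst e" X r] by (auto simp: PiE_iff path_set_iff)
  moreover obtain x \<gamma> \<eta> y where "e = ((x, \<gamma>), \<eta>, y)"
    by (metis surj_pair)
  ultimately show "?\<eta> (?\<theta> e) = e"
    using assms \<eta> by (auto simp: fun_eq_iff extensional_def)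
next
  fix e assume e: "e \<in> topspace ?L"
  have "fst e \<in> extensional {..<Suc r}" "snd e \<in> extensional {..<r}"
    "\<And>j. j < r \<Longrightarrow> snd e j \<in> extensional {0..1}"
    using segal_limit_point(1,2)[OF e] by (auto simp: PiE_iff path_set_iff)
  moreover obtain m where "r = Suc m"
    using assms by (cases r) auto
  ultimately show "(\<lambda>e. (\<lambda>j\<in>{..<Suc r}. if j < r then fst (fst e) j else snd (snd e),
          \<lambda>j\<in>{..<Suc r - 1}. restrict (if j < r - 1 then snd (fst e) j else fst (snd e)) {0..1}))
     ((\<lambda>j\<in>{..<r}. fst e j, \<lambda>j\<in>{..<r - 1}. restrict (snd e j) {0..1}),
    restrict (snd e (r - 1)) {0..1}, fst e r) = e"
    by (cases e) (auto simp: fun_eq_iff extensional_def less_Suc_eq)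
qed

text \<open>Splitting off the last edge, applying the Segal map for \<open>r\<close> and regrouping
  is an equivalence. It differs from the Segal map for \<open>r + 1\<close> because it restricts
  along \<open>\<delta>\<close> and then along \<open>e j\<close>, not along the composite edge; the
  cubes of the chains \<open>[tv, e j, \<delta>]\<close> and \<open>[sv, e j, \<delta>]\<close>
  supply the homotopy.\<close>

lemma segal_map_Suc:
  fixes r :: nat
  assumes X: "inf_presheaf Delta X" and r: "r \<ge> 1"
    and sq: "sends_to_pullback Delta X (last_vertex (int r)) (delta_top (int (Suc r)))
      source_vertex (last_edge (int (Suc r)))"
    and IH: "homotopy_equivalence (space_at X (int r)) (segal_limit X r) (segal_map X r)"
  shows "homotopy_equivalence (space_at X (int (Suc r))) (segal_limit X (Suc r)) (segal_map X (Suc r))"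
proof -
  define \<delta> e le lv tv sv where "\<delta> = delta_top (int (Suc r))" and "e = spine_edge r"
    and "le = last_edge (int (Suc r))" and "lv = last_vertex (int r)" and "tv = target_vertex" and "sv = source_vertex"
  note defs = \<delta>_def e_def le_def lv_def tv_def sv_def
  note arrow_defs = defs delta_top_def spine_edge_def last_edge_def last_vertex_def target_vertex_def source_vertex_def
  have arr: "\<delta> \<in> Arr Delta" "le \<in> Arr Delta" "lv \<in> Arr Delta" "tv \<in> Arr Delta" "sv \<in> Arr Delta"
    "\<And>j. j < r \<Longrightarrow> e j \<in> Arr Delta"
    using r by (auto simp: arrow_defs mono_on_def)
  have dom: "Dom Delta \<delta> = int r" "Cod Delta \<delta> = int (Suc r)" "Dom Delta le = 1" "Cod Delta le = int (Suc r)"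
    "Dom Delta lv = 0" "Cod Delta lv = int r" "Dom Delta tv = 0" "Cod Delta tv = 1" "Dom Delta sv = 0" "Cod Delta sv = 1"
    "\<And>j. Dom Delta (e j) = 1" "\<And>j. Cod Delta (e j) = int r"
    by (auto simp: arrow_defs)
  have eqs: "Cmp Delta (e (r - Suc 0)) tv = lv" "Cmp Delta \<delta> lv = Cmp Delta le sv"
    "\<And>j. Cmp Delta (e (Suc j)) sv = Cmp Delta (e j) tv"
    "\<And>j. j < r \<Longrightarrow> Cmp Delta \<delta> (e j) = spine_edge (Suc r) j" "spine_edge (Suc r) r = le"
    using r by (auto simp: arrow_defs compose_def fun_eq_iff of_nat_diff)
  define Q where "Q = space_at X (int (Suc r))"
  define X1 where "X1 = space_at X 1"
  define X0 where "X0 = space_at X 0"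
  define Xr where "Xr = space_at X (int r)"
  note spaces = Q_def X1_def X0_def Xr_def
  \<comment> \<open>The square \<open>sq\<close> is formed over the last vertex of
    \<open>[r]\<close>, the Segal limit over the target of its last edge; \<open>K\<close> compares
    the two maps to \<open>X0\<close>.\<close>
  define K where "K = (\<lambda>x t. act X [tv, e (r - 1)] [1 - t] x)"
  have K: "path_family Xr X0 K (\<lambda>x. act X [tv] [] (fst (segal_map X r x) (r - 1))) (act X [lv] [])"
    using path_family_reverse[OF act2_path_family[OF X, of tv "e (r - 1)"]] arr r
    by (simp add: K_def spaces dom eqs segal_map_def flip: e_def)
  have tvc: "continuous_map (segal_limit X r) X0 (\<lambda>p. act X [tv] [] (fst p (r - 1)))"
  proof (rule continuous_map_comp[of X1 X0 "act X [tv] []"])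
    show "continuous_map X1 X0 (act X [tv] [])"
      using act1_continuous[OF X arr(4)] by (simp add: spaces dom)
    show "continuous_map (segal_limit X r) X1 (\<lambda>p. fst p (r - 1))"
      unfolding spaces using r by (intro continuous_map_segal_limit_vertex) simp
  qed
  define sqm where "sqm = (\<lambda>a. (act X [\<delta>] [] a, square_path X lv \<delta> sv le a, act X [le] [] a))"
  have 1: "homotopy_equivalence Q (homotopy_pullback Xr X1 X0 (act X [lv] []) (act X [sv] [])) sqm"
    using sq[folded defs] by (simp add: sends_to_pullback_def sqm_def spaces dom)
  have 2: "homotopy_equivalence (homotopy_pullback Xr X1 X0 (act X [lv] []) (act X [sv] []))
      (homotopy_pullback (segal_limit X r) X1 X0 (\<lambda>p. act X [tv] [] (fst p (r - 1))) (act X [sv] []))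
      (pullback_shift (segal_map X r) K)"
    using IH by (intro homotopy_equivalence_shift K tvc) (simp add: spaces)
  note 3 = homotopy_equivalence_segal_limit_Suc[OF r, of X, folded spaces tv_def sv_def]
  note he = homotopy_equivalence_compose[OF homotopy_equivalence_compose[OF 1 2] 3]
  \<comment> \<open>From the Segal map at \<open>s = 0\<close> to the composite equivalence at
    \<open>s = 1\<close>. The last edge is given by the same map \<open>le\<close> in both and does
    not move.\<close>
  define x where "x = (\<lambda>s a j. if j < r then act X [e j, \<delta>] [s] a else act X [le] [] a)"
  text \<open>The last path of the homotopy runs down \<open>act X [tv, e (r - 1), \<delta>] [_, s]\<close>, then follows the
    square path from parameter \<open>s\<close> on; \<open>v\<close> is the position on the latter, its two halves being
    \<open>v \<ge> 0\<close> and \<open>v \<le> 0\<close>.\<close>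
  define v where "v = (\<lambda>s t :: real. s + (1 + s) * (1 - 2 * t))"
  define c where "c = (\<lambda>s a j. if j < r - 1
      then path_join (\<lambda>t. act X [tv, e j, \<delta>] [1 - t, s] a) (\<lambda>t. act X [sv, e (Suc j), \<delta>] [t, s] a)
      else (\<lambda>t. if t \<le> 1/2 then act X [tv, e (r - 1), \<delta>] [clamp01 (1 - 2 * t), s] a
        else if - v s t \<le> 0 then act X [lv, \<delta>] [clamp01 (v s t)] a
        else act X [sv, le] [clamp01 (- v s t)] a))"
  let ?IQ = "prod_topology unit_interval Q"
  have act3: "continuous_map S X0 (\<lambda>y. act X [f, e j, \<delta>] [s y, t y] (k y))"
    if "f \<in> {tv, sv}" "j < r" "continuous_map S unit_interval s" "continuous_map S unit_interval t"
      "continuous_map S Q k" for f j S s t and k :: "'s \<Rightarrow> 'a"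
    using act3_continuous[OF X _ that(3,4), of f "e j" \<delta> k] that(1,2,5) arr by (auto simp: spaces dom)
  have faces: "act X [f, e j, \<delta>] [0, t] a = act X [Cmp Delta (e j) f, \<delta>] [t] a"
      "act X [f, e j, \<delta>] [t, 0] a = act X [f, Cmp Delta \<delta> (e j)] [t] a"
      "act X [f, e j, \<delta>] [1, t] a = act X [f] [] (act X [e j, \<delta>] [t] a)"
      "act X [f, e j, \<delta>] [t, 1] a = act X [f, e j] [t] (act X [\<delta>] [] a)"
    if "f \<in> {tv, sv}" "j < r" "a \<in> topspace Q" "0 \<le> t" "t \<le> 1" for f j a t
    using act3_faces[OF X, of f "e j" \<delta> a t] that arr by (auto simp: spaces dom)
  have ends: "act X [lv, \<delta>] [0] a = act X [sv, le] [0] a"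
    "act X [sv, le] [1] a = act X [sv] [] (act X [le] [] a)"
    "j < r \<Longrightarrow> act X [e j, \<delta>] [0] a = act X [spine_edge (Suc r) j] [] a"
    "j < r \<Longrightarrow> act X [e j, \<delta>] [1] a = act X [e j] [] (act X [\<delta>] [] a)"
    if "a \<in> topspace Q" for a j
    using act2_ends[OF X, of lv \<delta> a] act2_ends[OF X, of sv le a] act2_ends[OF X, of "e j" \<delta> a] that arr
    by (simp_all add: spaces dom eqs)
  have c_path: "path_family ?IQ X0 (\<lambda>p. c (fst p) (snd p) j)
      (\<lambda>p. act X [tv] [] (x (fst p) (snd p) j)) (\<lambda>p. act X [sv] [] (x (fst p) (snd p) (Suc j)))"
    if j: "j < r" for j
  proof (cases "j < r - 1")
    case True
    then have j': "j < r" "Suc j < r"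
      by auto
    \<comment> \<open>The two squares meet where their first coordinate is 0, since the target of
      edge \<open>j\<close> and the source of edge \<open>Suc j\<close> are the same vertex.\<close>
    let ?mid = "\<lambda>p. act X [Cmp Delta (e j) tv, \<delta>] [fst p] (snd p)"
    have s: "continuous_map (prod_topology ?IQ unit_interval) unit_interval (\<lambda>p. fst (fst p))"
      and a: "continuous_map (prod_topology ?IQ unit_interval) Q (\<lambda>p. snd (fst p))"
      by (rule continuous_map_proj)+
    have "path_family ?IQ X0 (\<lambda>p t. act X [tv, e j, \<delta>] [1 - t, fst p] (snd p))
        (\<lambda>p. act X [tv] [] (act X [e j, \<delta>] [fst p] (snd p))) ?mid"
      unfolding path_family_def using j'
      by (intro conjI act3 s a continuous_map_unit_compl continuous_map_snd) (auto simp: faces)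
    moreover have "path_family ?IQ X0 (\<lambda>p t. act X [sv, e (Suc j), \<delta>] [t, fst p] (snd p))
        ?mid (\<lambda>p. act X [sv] [] (act X [e (Suc j), \<delta>] [fst p] (snd p)))"
      unfolding path_family_def using j'
      by (intro conjI act3 s a continuous_map_snd) (auto simp: faces eqs)
    ultimately show ?thesis
      using path_family_join True j' by (simp add: c_def x_def)
  next
    case False
    then have j': "j = r - 1" "\<not> Suc j < r"
      using j by auto
    let ?S = "prod_topology ?IQ unit_interval"
    have s: "continuous_map ?S unit_interval (\<lambda>p. fst (fst p))"
      and a: "continuous_map ?S Q (\<lambda>p. snd (fst p))"
      by (rule continuous_map_proj)+
    have t: "continuous_map ?S euclideanreal snd"
      by (rule unit_interval_real) (rule continuous_map_snd)
    note s' = unit_interval_real[OF s]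
    have v: "continuous_map ?S euclideanreal (\<lambda>p. v (fst (fst p)) (snd p))"
      unfolding v_def
      by (intro continuous_map_add continuous_map_real_mult continuous_map_diff
          continuous_map_canonical_const s' t)
    have lv: "continuous_map ?S X0 (\<lambda>p. act X [lv, \<delta>] [clamp01 (v (fst (fst p)) (snd p))] (snd (fst p)))"
      using act2_continuous[OF X _ continuous_map_clamp[OF v], of lv \<delta>] a arr by (simp add: spaces dom)
    have le: "continuous_map ?S X0 (\<lambda>p. act X [sv, le] [clamp01 (- v (fst (fst p)) (snd p))] (snd (fst p)))"
      using act2_continuous[OF X _ continuous_map_clamp[OF continuous_map_minus[OF v]], of sv le] a arr
      by (simp add: spaces dom)
    \<comment> \<open>At \<open>t = 1/2\<close> one has \<open>v s t = s\<close>, and the face of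
      the cube there is \<open>act X [lv, \<delta>] [s]\<close> because \<open>e (r - 1)\<close>
      takes \<open>tv\<close> to \<open>lv\<close>.\<close>
    have glue: "act X [tv, e (r - 1), \<delta>] [clamp01 (1 - 2 * t), s] a =
        (if - v s t \<le> 0 then act X [lv, \<delta>] [clamp01 (v s t)] a else act X [sv, le] [clamp01 (- v s t)] a)"
      if "a \<in> topspace Q" "0 \<le> s" "s \<le> 1" "t = 1/2" for a s t
    proof -
      have "v s t = s" "1 - 2 * t = 0"
        using that(4) by (simp_all add: v_def)
      then show ?thesis
        using that(1-3) r faces(1)[of tv "r - 1" a s] by (simp add: eqs)
    qed
    have c_last: "c s a (r - 1) t = (if t \<le> 1/2 then act X [tv, e (r - 1), \<delta>] [clamp01 (1 - 2 * t), s] a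
        else if - v s t \<le> 0 then act X [lv, \<delta>] [clamp01 (v s t)] a
        else act X [sv, le] [clamp01 (- v s t)] a)" for s a t
      by (simp only: c_def less_irrefl if_False)
    have "continuous_map ?S X0 (\<lambda>p. c (fst (fst p)) (snd (fst p)) (r - 1) (snd p))"
      unfolding c_last
    proof (rule continuous_map_if_le[OF t])
      show "continuous_map ?S X0 (\<lambda>p. act X [tv, e (r - 1), \<delta>] [clamp01 (1 - 2 * snd p), fst (fst p)] (snd (fst p)))"
        using r by (intro act3 s a continuous_map_clamp continuous_map_diff continuous_map_real_mult
            continuous_map_canonical_const t) auto
      show "continuous_map ?S X0 (\<lambda>p. if - v (fst (fst p)) (snd p) \<le> 0
          then act X [lv, \<delta>] [clamp01 (v (fst (fst p)) (snd p))] (snd (fst p))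
          else act X [sv, le] [clamp01 (- v (fst (fst p)) (snd p))] (snd (fst p)))"
        by (intro continuous_map_if_le lv le continuous_map_minus v) (auto simp: ends)
      fix p assume "p \<in> topspace ?S" "snd p = 1/2"
      then show "act X [tv, e (r - 1), \<delta>] [clamp01 (1 - 2 * snd p), fst (fst p)] (snd (fst p)) =
          (if - v (fst (fst p)) (snd p) \<le> 0
           then act X [lv, \<delta>] [clamp01 (v (fst (fst p)) (snd p))] (snd (fst p))
           else act X [sv, le] [clamp01 (- v (fst (fst p)) (snd p))] (snd (fst p)))"
        by (intro glue) auto
    qed
    moreover have "c s a (r - 1) 0 = act X [tv] [] (x s a (r - 1))"
      "c s a (r - 1) 1 = act X [sv] [] (x s a r)" if "a \<in> topspace Q" "0 \<le> s" "s \<le> 1" for s a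
      using that r by (auto simp: c_def x_def v_def faces ends)
    ultimately show ?thesis
      using r j' by (auto simp: path_family_def)
  qed
  have "homotopic Q (segal_limit X (Suc r)) (segal_map X (Suc r))
      ((\<lambda>e. (\<lambda>j\<in>{..<Suc r}. if j < r then fst (fst e) j else snd (snd e),
          \<lambda>j\<in>{..<Suc r - 1}. restrict (if j < r - 1 then snd (fst e) j else fst (snd e)) {0..1})) \<circ>
        (pullback_shift (segal_map X r) K \<circ> sqm))"
  proof (rule homotopicI[where h = "\<lambda>s a. (\<lambda>j\<in>{..<Suc r}. x s a j, \<lambda>j\<in>{..<Suc r - 1}. restrict (c s a j) {0..1})"])
    show "continuous_map ?IQ (segal_limit X (Suc r))
        (\<lambda>p. (\<lambda>j\<in>{..<Suc r}. x (fst p) (snd p) j, \<lambda>j\<in>{..<Suc r - 1}. restrict (c (fst p) (snd p) j) {0..1}))"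
    proof (rule continuous_map_segal_limitI)
      show "continuous_map ?IQ (space_at X 1) (\<lambda>p. x (fst p) (snd p) j)" for j
        unfolding x_def
        using act2_continuous[OF X _ continuous_map_fst, of "e j" \<delta> Q snd] continuous_map_snd[of unit_interval Q]
          continuous_map_comp[OF act1_continuous[OF X arr(2)], of ?IQ snd] arr
        by (cases "j < r") (auto simp: spaces dom)
    qed (use c_path in \<open>simp add: spaces defs\<close>)
    fix a assume a: "a \<in> topspace Q"
    have "x 0 a j = act X [spine_edge (Suc r) j] [] a" if "j < Suc r" for j
      using a that by (cases "j < r") (auto simp: x_def ends eqs less_Suc_eq)
    moreover have "restrict (c 0 a j) {0..1} = square_path X tv (spine_edge (Suc r) j) sv (spine_edge (Suc r) (Suc j)) a"
      if "j < r" for j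
    proof (cases "j < r - 1")
      case True
      then show ?thesis
        using a by (auto simp: c_def square_path_def path_join_def fun_eq_iff faces eqs)
    next
      case False
      then have "j = r - 1" "Suc j = r"
        using that by auto
      then show ?thesis
        using a r by (auto simp: c_def square_path_def fun_eq_iff v_def faces eqs)
    qed
    ultimately show "(\<lambda>j\<in>{..<Suc r}. x 0 a j, \<lambda>j\<in>{..<Suc r - 1}. restrict (c 0 a j) {0..1}) = segal_map X (Suc r) a"
      by (auto simp: segal_map_def fun_eq_iff simp flip: tv_def sv_def)
    have "x 1 a j = (if j < r then fst (fst (pullback_shift (segal_map X r) K (sqm a))) j
        else snd (snd (pullback_shift (segal_map X r) K (sqm a))))" for j
      using a by (auto simp: x_def ends pullback_shift_def sqm_def segal_map_def simp flip: e_def)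
    moreover have "restrict (c 1 a j) {0..1} = restrict (if j < r - 1 then snd (fst (pullback_shift (segal_map X r) K (sqm a))) j
        else fst (snd (pullback_shift (segal_map X r) K (sqm a)))) {0..1}" if "j < r" for j
    proof (cases "j < r - 1")
      case True
      then show ?thesis
        using a by (auto simp: c_def square_path_def path_join_def fun_eq_iff faces pullback_shift_def
            sqm_def segal_map_def simp flip: e_def tv_def sv_def)
    next
      case False
      \<comment> \<open>For \<open>s = 1\<close> the cube degenerates to \<open>K\<close> at
        \<open>act X [\<delta>] [] a\<close>, and \<open>v 1 t = 3 - 4 * t\<close> traverses the
        whole square path.\<close>
      have "c 1 a j t = path_join (K (act X [\<delta>] [] a)) (square_path X lv \<delta> sv le a) t" if t: "t \<in> {0..1}" for t
      proof -
        consider "t \<le> 1/2" | "1/2 < t" "t \<le> 3/4" | "3/4 < t"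
          by linarith
        then show ?thesis
          by cases (use a r t False in \<open>auto simp: c_def v_def K_def path_join_def square_path_def faces\<close>)
      qed
      then show ?thesis
        using False by (auto simp: pullback_shift_def sqm_def fun_eq_iff)
    qed
    ultimately show "(\<lambda>j\<in>{..<Suc r}. x 1 a j, \<lambda>j\<in>{..<Suc r - 1}. restrict (c 1 a j) {0..1}) =
      ((\<lambda>e. (\<lambda>j\<in>{..<Suc r}. if j < r then fst (fst e) j else snd (snd e),
          \<lambda>j\<in>{..<Suc r - 1}. restrict (if j < r - 1 then snd (fst e) j else fst (snd e)) {0..1})) \<circ>
        (pullback_shift (segal_map X r) K \<circ> sqm)) a"
      by (simp add: fun_eq_iff)
  qed
  from homotopy_equivalence_homotopic[OF he[unfolded spaces[symmetric]] homotopic_sym[OF this]]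
  show ?thesis
    by (simp add: Q_def)
qed

theorem proposition7p2p17:
  fixes A :: "(int, order_map, 'a) presheaf"
  assumes "flanked_decomposition_space A"
  shows "segal_space (underlying A)"
  unfolding segal_space_def
proof (intro conjI allI impI)
  show inf: "inf_presheaf Delta (underlying A)"
    using assms by (simp add: flanked_decomposition_space_def decomposition_space_def)
  fix r :: nat assume "1 \<le> r"
  then show "homotopy_equivalence (space_at (underlying A) (int r)) (segal_limit (underlying A) r)
      (segal_map (underlying A) r)"
  proof (induction r rule: dec_induct)
    case base
    show ?case
      using segal_map_one[OF inf] by simp
  next
    case (step r)
    show ?case
      using flanked_last_edge_square[OF assms, of "int (Suc r)"] step
      by (intro segal_map_Suc[OF inf]) auto
  qed
qed

end
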